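(* Let $1\le m,k\le n-1$ and $\alpha\in\mathbb C$. When considering $\mathcal C^\alpha_{m,k}$ and $\mathcal C^{*,\alpha}_{m,k}$ assume $m\le k$; when considering $\mathcal S^\alpha_{m,k}$ and $\mathcal S^{*,\alpha}_{m,k}$ assume $m\le n-k$. (i) The integrals defining $\mathcal C^\alpha_{m,k}f$, $\mathcal C^{*,\alpha}_{m,k}\varphi$, $\mathcal S^\alpha_{m,k}f$, $\mathcal S^{*,\alpha}_{m,k}\varphi$ converge absolutely almost everywhere for all $f\in L^1(V_{n,m})$ and all $\varphi\in L^1(V_{n,k})$ if and only if $\mathrm{Re}\,\alpha>m-1$. (ii) If $1\le m\le k\le n-1$ and $\mathrm{Re}\,\alpha>m-1$, then for all $f\in L^1(V_{n,m})$ and $\varphi\in L^1(V_{n,k})$ $$\int_{V_{n,k}}(\mathcal C^\alpha_{m,k}f)(u)\,d_*u=c_1\int_{V_{n,m}}f(v)\,d_*v,\qquad \int_{V_{n,m}}(\mathcal C^{*,\alpha}_{m,k}\varphi)(v)\,d_*v=c_1\int_{V_{n,k}}\varphi(u)\,d_*u,$$ $$c_1=\frac{\Gamma_m(n/2)\,\Gamma_m(\alpha/2)}{\Gamma_m(k/2)\,\Gamma_m((\alpha+n-k)/2)}.$$ (iii) If $1\le m\le n-k$ and $\mathrm{Re}\,\alpha>m-1$, then for all $f\in L^1(V_{n,m})$ and $\varphi\in L^1(V_{n,k})$ $$\int_{V_{n,k}}(\mathcal S^\alpha_{m,k}f)(u)\,d_*u=c_2\int_{V_{n,m}}f(v)\,d_*v,\qquad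 \int_{V_{n,m}}(\mathcal S^{*,\alpha}_{m,k}\varphi)(v)\,d_*v=c_2\int_{V_{n,k}}\varphi(u)\,d_*u,$$ $$c_2=\frac{\Gamma_m(n/2)\,\Gamma_m(\alpha/2)}{\Gamma_m((n-k)/2)\,\Gamma_m((\alpha+k)/2)}.$$
   Context: $V_{n,m}=\{v\in M_{n,m}(\mathbb R): v'v=I_m\}$ is the Stiefel manifold of orthonormal $m$-frames in $\mathbb R^n$, with $O(n)$-invariant probability measure $d_*v$ (and $L^1$ with respect to it). For a square matrix $a$, $|a|$ denotes $|\det a|$. The Siegel gamma function is $$\Gamma_m(\alpha)=\pi^{m(m-1)/4}\prod_{j=0}^{m-1}\Gamma(\alpha-j/2).$$ The cosine transform, dual cosine transform, sine transform and dual sine transform are $$(\mathcal C^\alpha_{m,k}f)(u)=\int_{V_{n,m}}f(v)\,|v'uu'v|^{(\alpha-k)/2}d_*v,\qquad (\mathcal C^{*,\alpha}_{m,k}\varphi)(v)=\int_{V_{n,k}}\varphi(u)\,|v'uu'v|^{(\alpha-k)/2}d_*u,$$ $$(\mathcal S^\alpha_{m,k}f)(u)=\int_{V_{n,m}}f(v)\,|I_m-v'uu'v|^{(\alpha+k-n)/2}d_*v,\qquad (\mathcal S^{*,\alpha}_{m,k}\varphi)(v)=\int_{V_{n,k}}\varphi(u)\,|I_m-v'uu'v|^{(\alpha+k-n)/2}d_*u,$$ for $u\in V_{n,k}$, $v\in V_{n,m}$. *)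

theory Defs
  imports "HOL-Probability.Probability_Measure"
begin

text \<open>
  An $n \times m$ real matrix is an element of \<^typ>\<open>real^'m^'n\<close>, so that
  $n$, $m$, $k$ are \<^term>\<open>CARD('n)\<close>, \<^term>\<open>CARD('m)\<close>, \<^term>\<open>CARD('k)\<close>.
\<close>

definition stiefel :: "(real^'m^'n) set"
  where "stiefel = {v. transpose v ** v = mat 1}"

text \<open>
  The measure $d_*v$, characterised as an $O(n)$-invariant Borel probability measure on the
  Stiefel manifold; such a measure exists and is unique, as $O(n)$ is compact and acts
  transitively.
\<close>

definition invariant_stiefel_measure :: "(real^'m^'n) measure \<Rightarrow> bool"
  where "invariant_stiefel_measure M \<longleftrightarrow>
    prob_space M \<and>
    sets M = sets (restrict_space borel stiefel) \<and>
    (\<forall>Q :: real^'n^'n. orthogonal_matrix Q \<longrightarrow> distr M M (\<lambda>v. Q ** v) = M)"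

definition siegel_Gamma :: "nat \<Rightarrow> complex \<Rightarrow> complex"
  where "siegel_Gamma m \<alpha> =
    of_real (pi powr (real m * (real m - 1) / 4)) * (\<Prod>j<m. Gamma (\<alpha> - of_nat j / 2))"

text \<open>
  In the kernels, \<^const>\<open>powr\<close> returns 0 at base 0 for every exponent.  For $m \le k$
  (cosine) and $m \le n - k$ (sine), the determinant vanishes only on a null set of $v$ for
  each $u$ and only on a null set of $u$ for each $v$, so the integrals below do not see this
  value.
\<close>

definition cosine_kernel :: "complex \<Rightarrow> real^'m^'n \<Rightarrow> real^'k^'n \<Rightarrow> complex"
  where "cosine_kernel \<alpha> v u =
    of_real \<bar>det (transpose v ** u ** transpose u ** v)\<bar> powr ((\<alpha> - of_nat CARD('k)) / 2)"

definition sine_kernel :: "complex \<Rightarrow> real^'m^'n \<Rightarrow> real^'k^'n \<Rightarrow> complex"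
  where "sine_kernel \<alpha> v u =
    of_real \<bar>det (mat 1 - transpose v ** u ** transpose u ** v)\<bar>
      powr ((\<alpha> + of_nat CARD('k) - of_nat CARD('n)) / 2)"

definition cosine_transform ::
    "(real^'m^'n) measure \<Rightarrow> complex \<Rightarrow> (real^'m^'n \<Rightarrow> complex) \<Rightarrow> real^'k^'n \<Rightarrow> complex"
  where "cosine_transform \<mu> \<alpha> f u = (\<integral>v. f v * cosine_kernel \<alpha> v u \<partial>\<mu>)"

definition dual_cosine_transform ::
    "(real^'k^'n) measure \<Rightarrow> complex \<Rightarrow> (real^'k^'n \<Rightarrow> complex) \<Rightarrow> real^'m^'n \<Rightarrow> complex"
  where "dual_cosine_transform \<nu> \<alpha> \<phi> v = (\<integral>u. \<phi> u * cosine_kernel \<alpha> v u \<partial>\<nu>)"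

definition sine_transform ::
    "(real^'m^'n) measure \<Rightarrow> complex \<Rightarrow> (real^'m^'n \<Rightarrow> complex) \<Rightarrow> real^'k^'n \<Rightarrow> complex"
  where "sine_transform \<mu> \<alpha> f u = (\<integral>v. f v * sine_kernel \<alpha> v u \<partial>\<mu>)"

definition dual_sine_transform ::
    "(real^'k^'n) measure \<Rightarrow> complex \<Rightarrow> (real^'k^'n \<Rightarrow> complex) \<Rightarrow> real^'m^'n \<Rightarrow> complex"
  where "dual_sine_transform \<nu> \<alpha> \<phi> v = (\<integral>u. \<phi> u * sine_kernel \<alpha> v u \<partial>\<nu>)"

end

theory Submission
  imports Defs "HOL-Probability.Probability"
begin

text \<open>
  Both kernels have the form \<open>\<bar>det (v\<^sup>T P v)\<bar>\<close> to the power \<open>(\<alpha> - r) / 2\<close>, where \<open>P\<close> is an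
  orthogonal projection of rank \<open>r\<close>: for the cosine transform \<open>P\<close> is the projection \<open>u u\<^sup>T\<close> onto the
  span of the frame \<open>u\<close>, of rank \<open>r = k\<close>; for the sine transform it is the complementary projection,
  of rank \<open>r = n - k\<close>.  By Fubini's theorem every claim reduces to the value \<open>A\<close> of
  the integral of this kernel over \<open>u\<close>, which does not depend on \<open>v\<close> because \<open>O(n)\<close> acts transitively
  on frames, and which equals the integral over \<open>v\<close> with \<open>u\<close> fixed.

  To find \<open>A\<close>, replace the frame \<open>v\<close> by a matrix \<open>X\<close> with \<open>m\<close> independent Gaussian columns in
  \<open>\<real>\<^sup>n\<close>.  Such a matrix of full rank factors as \<open>X = v T\<close> with a frame \<open>v\<close> and a square matrix \<open>T\<close>,
  so that \<open>det (X\<^sup>T P X) = (det T)\<^sup>2 det (v\<^sup>T P v)\<close> and \<open>det (X\<^sup>T X) = (det T)\<^sup>2\<close>.  Hence, for every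
  \<open>X\<close>, the integral over \<open>u\<close> of \<open>\<bar>det (X\<^sup>T P X)\<bar>\<^sup>s\<close> is \<open>A \<bar>det (X\<^sup>T X)\<bar>\<^sup>s\<close>
  (\<open>integral_kernel_columns\<close>).  Taking the expectation over \<open>X\<close> and exchanging the integrals gives
  \<open>A M\<^sub>n(s) = M\<^sub>r(s)\<close>, where \<open>M\<^sub>d(s)\<close> is the \<open>s\<close>-th moment of the Gaussian Gram determinant for a
  projection of rank \<open>d\<close> (\<open>nn_integral_kernel_product\<close>, \<open>kernel_integral_complex\<close>).

  The moments are products of quotients of Gamma functions
  (\<open>nn_integral_gram_det\<close>, \<open>integral_gram_det_powr\<close>): Gaussian elimination splits off the factor
  \<open>\<bar>P x\<bar>\<^sup>2\<close> for one column \<open>x\<close> and leaves the Gram determinant of the other columns for a projection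
  of rank one less, and \<open>\<bar>P x\<bar>\<^sup>2\<close> has the Gamma distribution with shape parameter half the rank of
  \<open>P\<close>.  This is the origin of the Siegel Gamma functions in the constants.

  For convergence, \<open>M\<^sub>r(s)\<close> is finite exactly if \<open>Re \<alpha> > m - 1\<close>.  At the critical real exponent
  \<open>\<alpha> = m - 1\<close> the moment \<open>M\<^sub>r\<close> is infinite whereas \<open>M\<^sub>n\<close> is still finite, because \<open>r < n\<close>; so \<open>A\<close> is
  infinite there.  It stays infinite for smaller exponents because the determinant is bounded on
  frames (\<open>kernel_integral_infinite\<close>).  Testing the transforms on the constant function \<open>1\<close> then
  yields the necessity of the condition.
\<close>

(* The default rule rewrites a transposed matrix applied to a vector into a row vector times the
   matrix; the arguments below keep the transpose. *)
declare transpose_matrix_vector [simp del]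


section \<open>Rotation invariance of the Gaussian measure\<close>

lemma nn_integral_lborel_translate:
  fixes h :: "'a::euclidean_space \<Rightarrow> ennreal"
  assumes [measurable]: "h \<in> borel_measurable borel"
  shows "(\<integral>\<^sup>+x. h (c + x) \<partial>lborel) = (\<integral>\<^sup>+x. h x \<partial>lborel)"
proof -
  have "(\<integral>\<^sup>+x. h x \<partial>lborel) = (\<integral>\<^sup>+x. h x \<partial>distr lborel borel ((+) c))"
    by (simp add: lborel_distr_plus)
  also have "\<dots> = (\<integral>\<^sup>+x. h (c + x) \<partial>lborel)"
    by (simp add: nn_integral_distr)
  finally show ?thesis ..
qed

lemma nn_integral_lborel_reflect:
  fixes h :: "'a::euclidean_space \<Rightarrow> ennreal"
  assumes [measurable]: "h \<in> borel_measurable borel"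
  shows "(\<integral>\<^sup>+x. h (c - x) \<partial>lborel) = (\<integral>\<^sup>+x. h x \<partial>lborel)"
proof -
  have "(\<integral>\<^sup>+x. h x \<partial>lborel) = (\<integral>\<^sup>+x. h x \<partial>distr lborel borel (\<lambda>x. c + (-1) *\<^sub>R x))"
    by (subst lborel_affine[of "-1" c]) (simp_all add: density_1)
  also have "\<dots> = (\<integral>\<^sup>+x. h (c - x) \<partial>lborel)"
    by (subst nn_integral_distr) simp_all
  finally show ?thesis ..
qed

text \<open>
  Uniqueness of translation-invariant measures, carried out for the image of Lebesgue measure under
  \<open>f\<close>: evaluating the integral of \<open>h (f x) g (f x + y)\<close> over \<open>x\<close> and \<open>y\<close> in both orders gives
  \<open>\<integral>(h \<circ> f) \<cdot> \<integral>g = \<integral>h \<cdot> \<integral>(g \<circ> f)\<close>, and the indicator \<open>g\<close> of the unit ball is unchanged by \<open>f\<close>.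
\<close>
lemma nn_integral_lborel_orthogonal:
  fixes f :: "'a::euclidean_space \<Rightarrow> 'a" and h :: "'a \<Rightarrow> ennreal"
  assumes f: "orthogonal_transformation f" and [measurable]: "h \<in> borel_measurable borel"
  shows "(\<integral>\<^sup>+x. h (f x) \<partial>lborel) = (\<integral>\<^sup>+x. h x \<partial>lborel)"
proof -
  have lin: "linear f"
    using f by (rule orthogonal_transformation_linear)
  have [measurable]: "f \<in> borel_measurable borel"
    by (intro borel_measurable_continuous_onI linear_continuous_on linear_conv_bounded_linear[THEN iffD1] lin)
  define g :: "'a \<Rightarrow> ennreal" where "g = indicator (ball 0 1)"
  have [measurable]: "g \<in> borel_measurable borel"
    unfolding g_def by (intro borel_measurable_indicator) simp
  have "(\<integral>\<^sup>+x. h (f x) \<partial>lborel) * (\<integral>\<^sup>+y. g y \<partial>lborel)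
      = (\<integral>\<^sup>+x. \<integral>\<^sup>+y. h (f x) * g (f x + y) \<partial>lborel \<partial>lborel)"
    by (simp add: nn_integral_multc nn_integral_cmult nn_integral_lborel_translate)
  also have "\<dots> = (\<integral>\<^sup>+y. \<integral>\<^sup>+x. h (f x) * g (f x + y) \<partial>lborel \<partial>lborel)"
    by (rule lborel_pair.Fubini') measurable
  also have "\<dots> = (\<integral>\<^sup>+y. \<integral>\<^sup>+x. h (f x - y) * g (f x) \<partial>lborel \<partial>lborel)"
  proof (rule nn_integral_cong)
    fix y
    obtain d where d: "f d = y"
      using orthogonal_transformation_surj[OF f] by (metis surjD)
    show "(\<integral>\<^sup>+x. h (f x) * g (f x + y) \<partial>lborel) = (\<integral>\<^sup>+x. h (f x - y) * g (f x) \<partial>lborel)"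
      using nn_integral_lborel_translate[of "\<lambda>x. h (f x) * g (f x + y)" "-d"]
      by (simp add: linear_diff[OF lin] d)
  qed
  also have "\<dots> = (\<integral>\<^sup>+x. \<integral>\<^sup>+y. h (f x - y) * g (f x) \<partial>lborel \<partial>lborel)"
    by (rule lborel_pair.Fubini') measurable
  also have "\<dots> = (\<integral>\<^sup>+x. h x \<partial>lborel) * (\<integral>\<^sup>+x. g (f x) \<partial>lborel)"
    by (simp add: nn_integral_multc nn_integral_cmult nn_integral_lborel_reflect)
  also have "(\<lambda>x. g (f x)) = g"
    by (auto simp: g_def fun_eq_iff indicator_def orthogonal_transformation_norm[OF f])
  finally have "(\<integral>\<^sup>+x. h (f x) \<partial>lborel) * (\<integral>\<^sup>+y. g y \<partial>lborel) =
    (\<integral>\<^sup>+x. h x \<partial>lborel) * (\<integral>\<^sup>+y. g y \<partial>lborel)" .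
  moreover have "(\<integral>\<^sup>+y. g y \<partial>lborel) = ennreal (unit_ball_vol (real DIM('a)))"
    by (simp add: g_def emeasure_ball)
  moreover have "unit_ball_vol (real DIM('a)) > 0" by simp
  ultimately show ?thesis
    by (simp add: mult.commute[of _ "ennreal _"] ennreal_mult_cancel_left ennreal_eq_0_iff not_le)
qed

text \<open>
  The ball of radius \<open>sqrt r\<close> has volume proportional to \<open>r\<close> to the power \<open>d / 2\<close>; differentiating
  this in \<open>r\<close> gives the density.
\<close>
lemma distr_sum_squares_lborel:
  fixes S :: "'i set"
  assumes S: "finite S" "S \<noteq> {}"
  defines "d \<equiv> real (card S)"
  shows "distr (Pi\<^sub>M S (\<lambda>_. lborel)) borel (\<lambda>x. \<Sum>i\<in>S. (x i)\<^sup>2) =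
    density lborel (\<lambda>r. ennreal (indicator {0<..} r * (unit_ball_vol d * (d / 2) * r powr (d / 2 - 1))))"
    (is "?L = density lborel ?g")
proof -
  have d: "d \<ge> 1"
    using S by (simp add: d_def Suc_le_eq card_gt_0_iff)
  have L: "emeasure ?L {..a} = (if a > 0 then ennreal (unit_ball_vol d * a powr (d / 2)) else 0)" for a
  proof -
    have pos: "emeasure ?L {..a} = ennreal (unit_ball_vol d * a powr (d / 2))" if "a > 0" for a
    proof -
      have "emeasure ?L {..a} = emeasure (Pi\<^sub>M S (\<lambda>_. lborel))
          ({f. sqrt (\<Sum>i\<in>S. (f i)\<^sup>2) \<le> sqrt a} \<inter> space (Pi\<^sub>M S (\<lambda>_. lborel)))"
        by (subst emeasure_distr) (auto intro!: arg_cong2[where f=emeasure])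
      also have "\<dots> = ennreal (unit_ball_vol d * sqrt a ^ card S)"
        using S that by (subst emeasure_cball_aux) (auto simp: d_def)
      also have "sqrt a ^ card S = a powr (d / 2)"
        using that by (simp add: d_def powr_half_sqrt[symmetric] powr_powr powr_realpow[symmetric])
      finally show ?thesis .
    qed
    \<comment> \<open>The volume formula concerns balls of positive radius; for \<open>a \<le> 0\<close> let the radius tend to 0.\<close>
    show ?thesis
    proof (cases "a > 0")
      case False
      have "emeasure ?L {..a} \<le> ennreal (unit_ball_vol d * e powr (d / 2))" if "e > 0" for e
        using emeasure_mono[of "{..a}" "{..e}" ?L] pos[OF that] that False by auto
      then have le: "emeasure ?L {..a} \<le> ennreal e'" if "e' > 0" for e'
      proof -
        have *: "unit_ball_vol d > 0" using d by simp
        define e where "e = (e' / unit_ball_vol d) powr (2 / d)"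
        have "e > 0" "unit_ball_vol d * e powr (d / 2) = e'"
          using that d * less_imp_neq[OF *] by (auto simp: e_def powr_powr)
        then show ?thesis
          using \<open>\<And>e. e > 0 \<Longrightarrow> emeasure ?L {..a} \<le> ennreal (unit_ball_vol d * e powr (d / 2))\<close>[of e] by simp
      qed
      have "emeasure ?L {..a} \<le> 0"
        by (rule ennreal_le_epsilon) (simp add: le)
      with False show ?thesis by simp
    qed (simp add: pos)
  qed
  have R: "emeasure (density lborel ?g) {..a} = (if a > 0 then ennreal (unit_ball_vol d * a powr (d / 2)) else 0)" for a
  proof (cases "a > 0")
    case True
    have "((\<lambda>x. x powr (d / 2 - 1)) has_integral (a powr (d / 2 - 1 + 1) / (d / 2 - 1 + 1))) {0..a}"
      using True d by (intro has_integral_powr_from_0) auto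
    then have "((\<lambda>x. (unit_ball_vol d * (d / 2)) * x powr (d / 2 - 1)) has_integral
        (unit_ball_vol d * (d / 2)) * (a powr (d / 2) / (d / 2))) {0..a}"
      by (intro has_integral_mult_right) simp
    then have *: "((\<lambda>x. unit_ball_vol d * (d / 2) * x powr (d / 2 - 1)) has_integral
        unit_ball_vol d * a powr (d / 2)) {0..a}"
      using d by simp
    have "emeasure (density lborel ?g) {..a} = (\<integral>\<^sup>+r. ?g r * indicator {..a} r \<partial>lborel)"
      by (subst emeasure_density) auto
    also have "\<dots> = (\<integral>\<^sup>+r. ennreal (unit_ball_vol d * (d / 2) * r powr (d / 2 - 1)) * indicator {0..a} r \<partial>lborel)"
      by (intro nn_integral_cong_AE AE_I[of _ _ "{0}"]) (auto simp: indicator_def)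
    also have "\<dots> = ennreal (unit_ball_vol d * a powr (d / 2))"
      by (rule nn_integral_has_integral_lebesgue'[OF _ *]) (use d in auto)
    finally show ?thesis using True by simp
  next
    case False
    then have z: "?g r * indicator {..a} r = 0" for r
      by (auto simp: indicator_def)
    have "emeasure (density lborel ?g) {..a} = (\<integral>\<^sup>+r. ?g r * indicator {..a} r \<partial>lborel)"
      by (subst emeasure_density) auto
    also have "\<dots> = 0"
      by (simp only: z nn_integral_const mult_zero_left)
    finally show ?thesis using False by simp
  qed
  show ?thesis
  proof (rule measure_eqI_generator_eq)
    show "Int_stable (range (\<lambda>a::real. {..a}))"
      by (auto simp: Int_stable_def)
    show "range (\<lambda>a::real. {..a}) \<subseteq> Pow UNIV" by simp
    show "sets ?L = sigma_sets UNIV (range (\<lambda>a::real. {..a}))"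
      "sets (density lborel ?g) = sigma_sets UNIV (range (\<lambda>a::real. {..a}))"
      by (simp_all add: borel_eq_atMost)
    show "emeasure ?L X = emeasure (density lborel ?g) X" if "X \<in> range (\<lambda>a::real. {..a})" for X
      using that L R by auto
    show "range (\<lambda>i. {..real i}) \<subseteq> range (\<lambda>a::real. {..a})" by auto
    show "(\<Union>i. {..real i}) = UNIV"
      by (auto intro: real_arch_simple)
    show "emeasure ?L {..real i} \<noteq> \<infinity>" for i
      by (subst L) auto
  qed
qed


lemma distr_PiM_lborel_vec_lambda:
  "distr (Pi\<^sub>M UNIV (\<lambda>_::'n::finite. lborel)) borel vec_lambda = (lborel :: (real^'n) measure)"
proof (rule lborel_eqI[symmetric])
  have [measurable]: "vec_lambda \<in> borel_measurable (Pi\<^sub>M UNIV (\<lambda>_::'n. lborel :: real measure))"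
    by (subst borel_measurable_euclidean_space) (auto simp: Basis_vec_def inner_axis)
  interpret product_sigma_finite "\<lambda>_::'n. lborel :: real measure"
    by standard
  fix l u :: "real^'n"
  assume le: "\<And>b. b \<in> Basis \<Longrightarrow> l \<bullet> b \<le> u \<bullet> b"
  have le': "l $ i \<le> u $ i" for i
    using le[of "axis i 1"] by (simp add: inner_axis)
  have "emeasure (distr (Pi\<^sub>M UNIV (\<lambda>_::'n. lborel)) borel vec_lambda) (box l u) =
      emeasure (Pi\<^sub>M UNIV (\<lambda>_::'n. lborel)) (Pi\<^sub>E UNIV (\<lambda>i. {l $ i<..<u $ i}))"
    by (subst emeasure_distr)
       (auto simp: space_PiM mem_box_cart PiE_def Pi_def intro!: arg_cong2[where f=emeasure])
  also have "\<dots> = (\<Prod>i\<in>UNIV. ennreal (u $ i - l $ i))"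
    using le' by (subst emeasure_PiM) auto
  also have "\<dots> = ennreal (\<Prod>i\<in>UNIV. u $ i - l $ i)"
    using le' by (subst prod_ennreal) auto
  also have "(\<Prod>i\<in>UNIV. u $ i - l $ i) = (\<Prod>b\<in>Basis. (u - l) \<bullet> b)"
    by (simp add: Basis_vec_def UNION_singleton_eq_range prod.reindex inj_on_def axis_eq_axis inner_axis)
  finally show "emeasure (distr (Pi\<^sub>M UNIV (\<lambda>_::'n. lborel)) borel vec_lambda) (box l u) =
      ennreal (\<Prod>b\<in>Basis. (u - l) \<bullet> b)" .
qed simp

definition gamma_density :: "real \<Rightarrow> real \<Rightarrow> real"
  where "gamma_density p r = indicator {0<..} r * r powr (p - 1) * exp (- r) / Gamma p"

lemma gamma_density_nonneg: "p > 0 \<Longrightarrow> gamma_density p r \<ge> 0"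
  by (simp add: gamma_density_def)

lemma gamma_density_measurable [measurable]: "gamma_density p \<in> borel_measurable borel"
  unfolding gamma_density_def[abs_def] by measurable

lemma nn_integral_gamma_density:
  assumes "p > 0"
  shows "(\<integral>\<^sup>+r. ennreal (gamma_density p r) \<partial>lborel) = 1"
proof -
  have "(\<integral>\<^sup>+r. ennreal (Gamma p) * ennreal (gamma_density p r) \<partial>lborel) =
      (\<integral>\<^sup>+r. ennreal (indicator {0..} r * r powr (p - 1) / exp r) \<partial>lborel)"
    using Gamma_real_pos[OF assms]
    by (intro nn_integral_cong_AE AE_I[of _ _ "{0}"])
       (auto simp: gamma_density_def indicator_def exp_minus field_simps ennreal_mult'[symmetric])
  also have "\<dots> = ennreal (Gamma p)"
    by (rule Gamma_conv_nn_integral_real[OF assms, symmetric])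
  finally have "ennreal (Gamma p) * (\<integral>\<^sup>+r. ennreal (gamma_density p r) \<partial>lborel) = ennreal (Gamma p) * 1"
    by (simp add: nn_integral_cmult)
  then show ?thesis
    using Gamma_real_pos[OF assms] unfolding ennreal_mult_cancel_left by (auto simp: ennreal_eq_0_iff)
qed

text \<open>
  The weight \<open>exp (- (norm x)\<^sup>2)\<close> factors over the coordinates in \<open>S\<close> and those outside.  The
  factor in front does not depend on \<open>h\<close>, so after normalisation of the weight the case \<open>h = 1\<close>
  determines it.
\<close>
lemma nn_integral_exp_norm_cylinder:
  fixes S :: "'n::finite set"
  assumes S: "S \<noteq> {}"
  defines "d \<equiv> real (card S)"
  assumes [measurable]: "h \<in> borel_measurable borel"
  shows "(\<integral>\<^sup>+x. h (\<Sum>i\<in>S. (x $ i)\<^sup>2) * ennreal (exp (- (norm x)\<^sup>2)) \<partial>(lborel :: (real^'n) measure)) =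
    (\<integral>\<^sup>+y. ennreal (exp (- (\<Sum>i\<in>-S. (y i)\<^sup>2))) \<partial>Pi\<^sub>M (-S) (\<lambda>_. lborel)) *
    (ennreal (unit_ball_vol d * (d / 2) * Gamma (d / 2)) *
     (\<integral>\<^sup>+r. h r * ennreal (gamma_density (d / 2) r) \<partial>lborel))"
proof -
  interpret product_sigma_finite "\<lambda>_::'n. lborel :: real measure"
    by standard
  have d: "d > 0"
    using S by (simp add: d_def card_gt_0_iff)
  have [measurable]: "vec_lambda \<in> borel_measurable (Pi\<^sub>M UNIV (\<lambda>_::'n. lborel :: real measure))"
    by (subst borel_measurable_euclidean_space) (auto simp: Basis_vec_def inner_axis)
  have "(\<integral>\<^sup>+x. h (\<Sum>i\<in>S. (x $ i)\<^sup>2) * ennreal (exp (- (norm x)\<^sup>2)) \<partial>(lborel :: (real^'n) measure)) =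
    (\<integral>\<^sup>+x. h (\<Sum>i\<in>S. (x i)\<^sup>2) * ennreal (exp (- (\<Sum>i\<in>UNIV. (x i)\<^sup>2))) \<partial>Pi\<^sub>M UNIV (\<lambda>_::'n. lborel))"
    by (subst distr_PiM_lborel_vec_lambda[symmetric], subst nn_integral_distr)
       (simp_all add: norm_vec_def L2_set_def sum_nonneg)
  also have "\<dots> = (\<integral>\<^sup>+x. h (\<Sum>i\<in>S. (x i)\<^sup>2) * ennreal (exp (- (\<Sum>i\<in>UNIV. (x i)\<^sup>2))) \<partial>Pi\<^sub>M (S \<union> -S) (\<lambda>_::'n. lborel))"
    by simp
  also have "\<dots> = (\<integral>\<^sup>+x. (\<integral>\<^sup>+y. h (\<Sum>i\<in>S. (x i)\<^sup>2) * ennreal (exp (- (\<Sum>i\<in>S. (x i)\<^sup>2))) *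
      ennreal (exp (- (\<Sum>i\<in>-S. (y i)\<^sup>2))) \<partial>Pi\<^sub>M (-S) (\<lambda>_. lborel)) \<partial>Pi\<^sub>M S (\<lambda>_. lborel))"
  proof (subst product_nn_integral_fold)
    have "(\<Sum>i\<in>UNIV. (merge S (-S) (x, y) i)\<^sup>2) = (\<Sum>i\<in>S. (x i)\<^sup>2) + (\<Sum>i\<in>-S. (y i)\<^sup>2)" for x y :: "'n \<Rightarrow> real"
      by (subst Compl_partition[symmetric, of S], subst sum.union_disjoint) (auto simp: merge_def)
    moreover have "(\<Sum>i\<in>S. (merge S (-S) (x, y) i)\<^sup>2) = (\<Sum>i\<in>S. (x i)\<^sup>2)" for x y :: "'n \<Rightarrow> real"
      by (auto simp: merge_def)
    ultimately show "(\<integral>\<^sup>+x. (\<integral>\<^sup>+y. h (\<Sum>i\<in>S. (merge S (-S) (x, y) i)\<^sup>2) *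
        ennreal (exp (- (\<Sum>i\<in>UNIV. (merge S (-S) (x, y) i)\<^sup>2))) \<partial>Pi\<^sub>M (-S) (\<lambda>_. lborel)) \<partial>Pi\<^sub>M S (\<lambda>_. lborel)) =
      (\<integral>\<^sup>+x. (\<integral>\<^sup>+y. h (\<Sum>i\<in>S. (x i)\<^sup>2) * ennreal (exp (- (\<Sum>i\<in>S. (x i)\<^sup>2))) *
      ennreal (exp (- (\<Sum>i\<in>-S. (y i)\<^sup>2))) \<partial>Pi\<^sub>M (-S) (\<lambda>_. lborel)) \<partial>Pi\<^sub>M S (\<lambda>_. lborel))"
      by (simp add: exp_add exp_minus ennreal_mult' mult_ac exp_diff divide_inverse)
  qed simp_all
  also have "\<dots> = (\<integral>\<^sup>+y. ennreal (exp (- (\<Sum>i\<in>-S. (y i)\<^sup>2))) \<partial>Pi\<^sub>M (-S) (\<lambda>_. lborel)) *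
      (\<integral>\<^sup>+x. h (\<Sum>i\<in>S. (x i)\<^sup>2) * ennreal (exp (- (\<Sum>i\<in>S. (x i)\<^sup>2))) \<partial>Pi\<^sub>M S (\<lambda>_. lborel))"
    by (simp add: nn_integral_cmult nn_integral_multc mult.commute)
  also have "(\<integral>\<^sup>+x. h (\<Sum>i\<in>S. (x i)\<^sup>2) * ennreal (exp (- (\<Sum>i\<in>S. (x i)\<^sup>2))) \<partial>Pi\<^sub>M S (\<lambda>_. lborel)) =
      (\<integral>\<^sup>+r. h r * ennreal (exp (- r)) \<partial>distr (Pi\<^sub>M S (\<lambda>_. lborel)) borel (\<lambda>x. \<Sum>i\<in>S. (x i)\<^sup>2))"
    by (subst nn_integral_distr) simp_all
  also have "\<dots> = (\<integral>\<^sup>+r. ennreal (unit_ball_vol d * (d / 2) * Gamma (d / 2)) *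
     (h r * ennreal (gamma_density (d / 2) r)) \<partial>lborel)"
    using d less_imp_neq[OF Gamma_real_pos[of "d / 2"]]
    by (subst distr_sum_squares_lborel[OF finite S, folded d_def], subst nn_integral_density)
       (auto intro!: nn_integral_cong simp: gamma_density_def indicator_def mult_ac ennreal_mult'[symmetric])
  also have "\<dots> = ennreal (unit_ball_vol d * (d / 2) * Gamma (d / 2)) *
     (\<integral>\<^sup>+r. h r * ennreal (gamma_density (d / 2) r) \<partial>lborel)"
    by (simp add: nn_integral_cmult)
  finally show ?thesis .
qed

definition gaussian_mass :: "'n::finite itself \<Rightarrow> ennreal"
  where "gaussian_mass _ = (\<integral>\<^sup>+x. ennreal (exp (- (norm x)\<^sup>2)) \<partial>(lborel :: (real^'n) measure))"

lemma gaussian_mass: "gaussian_mass TYPE('n::finite) \<noteq> 0" "gaussian_mass TYPE('n) \<noteq> \<infinity>"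
proof -
  let ?d = "real CARD('n)"
  interpret product_sigma_finite "\<lambda>_::'n. lborel :: real measure"
    by standard
  have "gaussian_mass TYPE('n) = ennreal (unit_ball_vol ?d * (?d / 2) * Gamma (?d / 2))"
    using nn_integral_exp_norm_cylinder[of "UNIV :: 'n set" "\<lambda>_. 1"]
    by (simp add: gaussian_mass_def nn_integral_gamma_density PiM_empty)
  moreover have "unit_ball_vol ?d * (?d / 2) * Gamma (?d / 2) > 0"
    by (intro mult_pos_pos) (auto intro!: Gamma_real_pos)
  ultimately obtain c where "gaussian_mass TYPE('n) = ennreal c" "c > 0"
    by blast
  then show "gaussian_mass TYPE('n) \<noteq> 0" "gaussian_mass TYPE('n) \<noteq> \<infinity>"
    by simp_all
qed

text \<open>
  With the weight \<open>exp (- (norm x)\<^sup>2)\<close>, that is, variance 1/2 in each coordinate, squared norms have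
  Gamma distributions of scale 1.
\<close>
definition gaussian :: "(real^'n) measure"
  where "gaussian = density lborel (\<lambda>x. ennreal (exp (- (norm x)\<^sup>2)) / gaussian_mass TYPE('n))"

lemma sets_gaussian [measurable_cong, simp]: "sets gaussian = sets borel"
  by (simp add: gaussian_def)

lemma space_gaussian [simp]: "space gaussian = UNIV"
  by (simp add: gaussian_def)

lemma nn_integral_gaussian:
  fixes h :: "real^'n \<Rightarrow> ennreal"
  assumes [measurable]: "h \<in> borel_measurable borel"
  shows "(\<integral>\<^sup>+x. h x \<partial>gaussian) = (\<integral>\<^sup>+x. h x * ennreal (exp (- (norm x)\<^sup>2)) \<partial>lborel) / gaussian_mass TYPE('n)"
  unfolding gaussian_def
  by (subst nn_integral_density, simp_all, subst nn_integral_divide[symmetric])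
     (simp_all add: divide_ennreal_def mult_ac)

lemma prob_space_gaussian: "prob_space (gaussian :: (real^'n) measure)"
proof
  have "emeasure (gaussian :: (real^'n) measure) (space gaussian) = (\<integral>\<^sup>+x. 1 \<partial>(gaussian :: (real^'n) measure))"
    by simp
  also have "\<dots> = gaussian_mass TYPE('n) / gaussian_mass TYPE('n)"
    by (subst nn_integral_gaussian) (simp_all add: gaussian_mass_def)
  also have "\<dots> = 1"
    using gaussian_mass[where 'n='n] by (simp add: ennreal_divide_self less_top)
  finally show "emeasure (gaussian :: (real^'n) measure) (space gaussian) = 1" .
qed

lemma nn_integral_gaussian_orthogonal:
  fixes f :: "real^'n \<Rightarrow> real^'n" and h :: "real^'n \<Rightarrow> ennreal"
  assumes f: "orthogonal_transformation f" and [measurable]: "h \<in> borel_measurable borel"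
  shows "(\<integral>\<^sup>+x. h (f x) \<partial>gaussian) = (\<integral>\<^sup>+x. h x \<partial>gaussian)"
proof -
  have lin: "linear f"
    using f by (rule orthogonal_transformation_linear)
  have [measurable]: "f \<in> borel_measurable borel"
    by (intro borel_measurable_continuous_onI linear_continuous_on linear_conv_bounded_linear[THEN iffD1] lin)
  show ?thesis
    using nn_integral_lborel_orthogonal[OF f, of "\<lambda>x. h x * ennreal (exp (- (norm x)\<^sup>2))"]
    by (simp add: nn_integral_gaussian orthogonal_transformation_norm[OF f])
qed

lemma nn_integral_gaussian_sum_squares:
  fixes S :: "'n::finite set"
  assumes S: "S \<noteq> {}" and [measurable]: "h \<in> borel_measurable borel"
  shows "(\<integral>\<^sup>+x. h (\<Sum>i\<in>S. (x $ i)\<^sup>2) \<partial>(gaussian :: (real^'n) measure)) =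
    (\<integral>\<^sup>+r. h r * ennreal (gamma_density (real (card S) / 2) r) \<partial>lborel)"
proof -
  obtain K where K: "\<And>h :: real \<Rightarrow> ennreal. h \<in> borel_measurable borel \<Longrightarrow>
      (\<integral>\<^sup>+x. h (\<Sum>i\<in>S. (x $ i)\<^sup>2) \<partial>(gaussian :: (real^'n) measure)) =
      K * (\<integral>\<^sup>+r. h r * ennreal (gamma_density (real (card S) / 2) r) \<partial>lborel)"
  proof
    fix h :: "real \<Rightarrow> ennreal" assume [measurable]: "h \<in> borel_measurable borel"
    show "(\<integral>\<^sup>+x. h (\<Sum>i\<in>S. (x $ i)\<^sup>2) \<partial>(gaussian :: (real^'n) measure)) =
      (\<integral>\<^sup>+y. ennreal (exp (- (\<Sum>i\<in>-S. (y i)\<^sup>2))) \<partial>Pi\<^sub>M (-S) (\<lambda>_. lborel)) *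
      ennreal (unit_ball_vol (real (card S)) * (real (card S) / 2) * Gamma (real (card S) / 2)) /
      gaussian_mass TYPE('n) *
      (\<integral>\<^sup>+r. h r * ennreal (gamma_density (real (card S) / 2) r) \<partial>lborel)"
      by (subst nn_integral_gaussian, measurable, subst nn_integral_exp_norm_cylinder)
         (use S in \<open>simp_all add: divide_ennreal_def mult_ac\<close>)
  qed
  interpret prob_space "gaussian :: (real^'n) measure"
    by (rule prob_space_gaussian)
  have "card S > 0" using S by (simp add: card_gt_0_iff)
  then have "K = 1"
    using K[of "\<lambda>_. 1"] emeasure_space_1 by (simp add: nn_integral_gamma_density)
  with K show ?thesis by simp
qed

section \<open>Orthogonal projections and orthonormal frames\<close>

text \<open>
  The rank of an orthogonal projection equals its trace.  Ranks are measured by traces throughout, since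
  traces are additive and invariant under conjugation.
\<close>
definition orth_projection :: "real^'n^'n \<Rightarrow> bool"
  where "orth_projection P \<longleftrightarrow> transpose P = P \<and> P ** P = P"

lemma inner_transpose: "x \<bullet> (A *v y) = (transpose A *v x) \<bullet> (y :: real^'n)" for A :: "real^'n^'m"
  by (metis dot_lmul_matrix vector_transpose_matrix transpose_transpose)

context
  fixes P :: "real^'n^'n"
  assumes P: "orth_projection P"
begin

lemma orth_projection_idem [simp]: "P *v (P *v x) = P *v x"
  using P by (simp add: orth_projection_def matrix_vector_mul_assoc)

lemma orth_projection_inner: "x \<bullet> (P *v y) = (P *v x) \<bullet> y"
  using P by (subst inner_transpose) (simp add: orth_projection_def)

lemma orth_projection_inner_self: "x \<bullet> (P *v x) = (norm (P *v x))\<^sup>2"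
  by (metis orth_projection_idem orth_projection_inner power2_norm_eq_inner)

lemma orth_projection_pythagoras: "(norm x)\<^sup>2 = (norm (P *v x))\<^sup>2 + (norm (x - P *v x))\<^sup>2"
  using orth_projection_inner_self[of x] unfolding power2_norm_eq_inner
  by (simp add: inner_diff_left inner_diff_right inner_commute)

lemma dim_kernel_orth_projection:
  "dim {x. P *v x = 0} + dim (range ((*v) P)) = CARD('n)"
proof -
  have "(\<forall>x. (P *v x) \<bullet> y = 0) \<longleftrightarrow> P *v y = 0" for y
    unfolding orth_projection_inner[symmetric] by (metis inner_eq_zero_iff inner_zero_right)
  then have "{y. \<forall>x\<in>range ((*v) P). orthogonal x y} = {x. P *v x = 0}"
    by (auto simp: orthogonal_def)
  moreover have "subspace (range ((*v) P))"
    by (intro linear_subspace_image) auto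
  ultimately show ?thesis
    using dim_subspace_orthogonal_to_vectors[of "range ((*v) P)" UNIV] by simp
qed

end

lemma orth_projection_norm_le: "orth_projection P \<Longrightarrow> norm (P *v x) \<le> norm x"
  by (rule power2_le_imp_le) (simp_all add: orth_projection_pythagoras[of P x])

lemma orth_projection_id: "orth_projection (mat 1)"
  by (simp add: orth_projection_def transpose_mat)

text \<open>
  The orthogonal complements of the two ranges have the same dimension, so some isometry
  between them exists; glued to \<open>f\<close> along the decomposition \<open>x = P x + (x - P x)\<close> it gives an
  isometry of the whole space.
\<close>
lemma orth_projection_extend_isometry:
  fixes P Q :: "real^'n^'n" and f :: "real^'n \<Rightarrow> real^'n"
  assumes P: "orth_projection P" and Q: "orth_projection Q"
    and dim: "dim (range ((*v) P)) = dim (range ((*v) Q))"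
    and f: "linear f" "\<And>x. norm (f (P *v x)) = norm (P *v x)" "\<And>x. Q *v f (P *v x) = f (P *v x)"
  obtains F where "orthogonal_matrix F" "\<And>x. F *v (P *v x) = f (P *v x)" "F ** P = Q ** F"
proof -
  have "subspace {x. P *v x = 0}" "subspace {x. Q *v x = 0}"
    by (auto simp: subspace_def matrix_vector_right_distrib scaleR_matrix_vector_assoc[symmetric]
        matrix_vector_mult_scaleR)
  moreover have "dim {x. P *v x = 0} = dim {x. Q *v x = 0}"
    using dim_kernel_orth_projection[OF P] dim_kernel_orth_projection[OF Q] dim by simp
  ultimately obtain g where g: "linear g" "g ` {x. P *v x = 0} = {x. Q *v x = 0}"
      "\<And>x. P *v x = 0 \<Longrightarrow> norm (g x) = norm x"
    by (rule isometries_subspaces) blast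
  have ker: "P *v (x - P *v x) = 0" for x
    by (simp add: matrix_vector_mult_diff_distrib P)
  have Qg: "Q *v g (x - P *v x) = 0" for x
    using g(2) ker by blast
  define h where "h x = f (P *v x) + g (x - P *v x)" for x
  have lin: "linear h"
    unfolding h_def using f(1) g(1)
    by (auto intro!: linearI simp: linear_add linear_diff linear_cmul matrix_vector_right_distrib
        matrix_vector_mult_scaleR algebra_simps)
  have "norm (h x) = norm x" for x
  proof -
    have "f (P *v x) \<bullet> g (x - P *v x) = 0"
      by (metis Q Qg f(3) inner_zero_right orth_projection_inner)
    then have "(norm (h x))\<^sup>2 = (norm (f (P *v x)))\<^sup>2 + (norm (g (x - P *v x)))\<^sup>2"
      by (simp add: h_def power2_norm_eq_inner inner_add_left inner_add_right inner_commute)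
    also have "\<dots> = (norm x)\<^sup>2"
      using g(3)[OF ker] f(2) by (simp add: orth_projection_pythagoras[OF P, of x])
    finally show ?thesis by simp
  qed
  then have "orthogonal_transformation h"
    using lin by (simp add: orthogonal_transformation)
  then have orth: "orthogonal_matrix (matrix h)"
    by (simp add: orthogonal_transformation_matrix)
  have h: "matrix h *v x = h x" for x
    using lin by (simp add: matrix_works)
  show ?thesis
  proof
    show "matrix h *v (P *v x) = f (P *v x)" for x
      using linear_0[OF g(1)] by (simp add: h h_def P)
    show "matrix h ** P = Q ** matrix h"
      unfolding matrix_eq using linear_0[OF g(1)]
      by (simp add: matrix_vector_mul_assoc[symmetric] h h_def P matrix_vector_right_distrib Qg f(3))
  qed (rule orth)
qed

lemma transpose_frame_cancel:
  fixes v :: "real^'m^'n"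
  assumes "transpose v ** v = mat 1"
  shows "transpose v *v (v *v x) = x"
  by (simp add: matrix_vector_mul_assoc assms)

lemma norm_orthonormal_frame:
  fixes v :: "real^'m^'n"
  assumes "transpose v ** v = mat 1"
  shows "norm (v *v x) = norm x"
proof -
  have "(v *v x) \<bullet> (v *v x) = x \<bullet> x"
    by (subst inner_transpose) (simp add: transpose_frame_cancel[OF assms])
  then show ?thesis by (simp add: norm_eq_sqrt_inner)
qed

lemma orthogonal_matrix_norm:
  assumes "orthogonal_matrix F" shows "norm (F *v x) = norm (x :: real^'n)"
  using assms by (intro norm_orthonormal_frame) (simp add: orthogonal_matrix_def)

text \<open>
  Apply \<open>orth_projection_extend_isometry\<close> to \<open>P\<close> and a coordinate projection of the same rank.
\<close>
lemma orth_projection_diagonalize: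
  fixes P :: "real^'n^'n"
  assumes P: "orth_projection P"
  obtains F S where "orthogonal_matrix F" "trace P = real (card S)"
    "\<And>x. (norm (P *v x))\<^sup>2 = (\<Sum>i\<in>S. ((F *v x) $ i)\<^sup>2)"
proof -
  have "dim (range ((*v) P)) \<le> CARD('n)"
    using dim_subset_UNIV[of "range ((*v) P)"] by simp
  then obtain S :: "'n set" where S: "card S = dim (range ((*v) P))"
    by (metis obtain_subset_with_card_n)
  define D :: "real^'n^'n" where "D = (\<chi> i j. if i = j then (if i \<in> S then 1 else 0) else 0)"
  have D_mult: "D *v x = (\<chi> i. if i \<in> S then x $ i else 0)" for x
    by (simp add: D_def matrix_vector_mult_def vec_eq_iff if_distrib[of "\<lambda>c. c * _"] cong: if_cong)
  have "transpose D = D"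
    by (simp add: D_def transpose_def vec_eq_iff)
  moreover have "D ** D = D"
    unfolding matrix_eq matrix_vector_mul_assoc[symmetric] D_mult by (simp add: vec_eq_iff)
  ultimately have D: "orth_projection D"
    by (simp add: orth_projection_def)
  have "range ((*v) D) = {x. \<forall>i. i \<notin> S \<longrightarrow> x $ i = 0}"
  proof (intro equalityI subsetI)
    fix x :: "real^'n" assume "x \<in> {x. \<forall>i. i \<notin> S \<longrightarrow> x $ i = 0}"
    then have "x = D *v x" by (auto simp: D_mult vec_eq_iff)
    then show "x \<in> range ((*v) D)" by blast
  qed (auto simp: D_mult)
  then have dimD: "dim (range ((*v) D)) = card S"
    using dim_substandard_cart[where 'a=real and d=S] by (simp add: dim_vec_eq)
  have "subspace (range ((*v) P))" "subspace (range ((*v) D))"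
    by (intro linear_subspace_image; simp)+
  then obtain f where f: "linear f" "f ` range ((*v) P) = range ((*v) D)"
      "\<And>x. x \<in> range ((*v) P) \<Longrightarrow> norm (f x) = norm x"
    using S dimD by (metis isometries_subspaces)
  have fD: "D *v f (P *v x) = f (P *v x)" for x
    using f(2) orth_projection_idem[OF D] by (metis (no_types, lifting) imageE image_eqI rangeI)
  obtain F where F: "orthogonal_matrix F" "\<And>x. F *v (P *v x) = f (P *v x)" "F ** P = D ** F"
    by (rule orth_projection_extend_isometry[OF P D _ f(1) _ fD]) (use S dimD f(3) in auto)
  show ?thesis
  proof
    have "P = transpose F ** (F ** P)"
      using F(1) by (simp add: matrix_mul_assoc orthogonal_matrix_def)
    then have "trace P = trace (F ** P ** transpose F)"
      by (metis trace_mul_sym)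
    also have "F ** P ** transpose F = D"
      unfolding F(3) using F(1) by (simp add: matrix_mul_assoc[symmetric] orthogonal_matrix_def)
    also have "trace D = real (card S)"
      by (simp add: trace_def D_def sum.If_cases)
    finally show "trace P = real (card S)" .
    fix x
    have "norm (P *v x) = norm (F *v (P *v x))"
      using F(1) by (simp add: orthogonal_matrix_norm)
    also have "F *v (P *v x) = D *v (F *v x)"
      by (simp add: matrix_vector_mul_assoc F(3))
    also have "(norm (D *v (F *v x)))\<^sup>2 = (\<Sum>i\<in>S. ((F *v x) $ i)\<^sup>2)"
      unfolding D_mult power2_norm_eq_inner inner_vec_def
      by (simp add: if_distrib[of "\<lambda>c. c * _"] sum.If_cases power2_eq_square cong: if_cong)
    finally show "(norm (P *v x))\<^sup>2 = (\<Sum>i\<in>S. ((F *v x) $ i)\<^sup>2)" .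
  qed (rule F(1))
qed

lemma orth_projection_frame:
  fixes v :: "real^'m^'n"
  assumes v: "transpose v ** v = mat 1"
  shows "orth_projection (v ** transpose v)"
proof -
  have "v ** transpose v ** v = v"
    by (simp add: matrix_mul_assoc[symmetric] v)
  then show ?thesis
    by (simp add: orth_projection_def matrix_transpose_mul matrix_mul_assoc)
qed

lemma range_frame_projection:
  fixes v :: "real^'m^'n"
  assumes v: "transpose v ** v = mat 1"
  shows "range ((*v) (v ** transpose v)) = range ((*v) v)"
proof -
  have "(v ** transpose v) *v (v *v x) = v *v x" for x
    by (simp add: matrix_vector_mul_assoc[symmetric] transpose_frame_cancel[OF v])
  then have "v *v x \<in> range ((*v) (v ** transpose v))" for x
    using rangeI[of "(*v) (v ** transpose v)" "v *v x"] by simp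
  then show ?thesis
    by (auto simp: matrix_vector_mul_assoc[symmetric])
qed

text \<open>
  The map \<open>w v\<^sup>T\<close> is isometric on the span of \<open>v\<close> and carries \<open>v\<close> to \<open>w\<close>; extend it to the whole
  space.
\<close>
lemma orthogonal_matrix_transitive_on_frames:
  fixes v w :: "real^'m^'n"
  assumes v: "transpose v ** v = mat 1" and w: "transpose w ** w = mat 1"
  obtains F where "orthogonal_matrix F" "F ** v = w"
proof -
  let ?P = "v ** transpose v" and ?Q = "w ** transpose w" and ?f = "\<lambda>x. w *v (transpose v *v x)"
  have dim: "dim (range ((*v) u)) = CARD('m)" if "transpose u ** u = mat 1" for u :: "real^'m^'n"
  proof -
    have "inj ((*v) u)"
      using that matrix_left_invertible_injective[of u] by blast
    then show ?thesis by (simp add: dim_image_eq)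
  qed
  have 1: "?f (?P *v x) = w *v (transpose v *v x)" for x
    by (simp add: matrix_vector_mul_assoc[symmetric] transpose_frame_cancel[OF v])
  have 2: "?Q *v (w *v x) = w *v x" for x
    by (simp add: matrix_vector_mul_assoc[symmetric] transpose_frame_cancel[OF w])
  have 3: "linear ?f"
    using linear_compose[of "(*v) (transpose v)" "(*v) w"] by (simp add: o_def)
  have 4: "norm (?f (?P *v x)) = norm (?P *v x)" for x
    unfolding 1 by (simp add: norm_orthonormal_frame[OF w] norm_orthonormal_frame[OF v]
        matrix_vector_mul_assoc[symmetric])
  obtain F where F: "orthogonal_matrix F" "\<And>x. F *v (?P *v x) = ?f (?P *v x)"
    by (rule orth_projection_extend_isometry[OF orth_projection_frame[OF v] orth_projection_frame[OF w] _ 3 4])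
       (auto simp: range_frame_projection v w dim 2)
  have "F ** v = w"
  proof (subst matrix_eq, rule allI)
    fix x
    have "?P *v (v *v x) = v *v x"
      by (simp add: matrix_vector_mul_assoc[symmetric] transpose_frame_cancel[OF v])
    then show "F ** v *v x = w *v x"
      using F(2)[of "v *v x"] by (simp add: matrix_vector_mul_assoc[symmetric] transpose_frame_cancel[OF v])
  qed
  with F(1) show ?thesis by (rule that)
qed

text \<open>
  \<open>X\<^sup>T X x = 0\<close> forces \<open>(X x) \<bullet> (X x) = 0\<close>, so \<open>X\<close> and \<open>X\<^sup>T X\<close> have the same kernel.
\<close>
lemma gram_det_nonzero_iff: "det (transpose X ** X) \<noteq> 0 \<longleftrightarrow> inj ((*v) X)" for X :: "real^'m^'n"
proof -
  have "X *v x = 0" if "(transpose X ** X) *v x = 0" for x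
  proof -
    have "(X *v x) \<bullet> (X *v x) = (transpose X *v (X *v x)) \<bullet> x"
      by (rule inner_transpose)
    then show ?thesis
      using that by (simp add: matrix_vector_mul_assoc)
  qed
  then have ker: "(\<forall>x. (transpose X ** X) *v x = 0 \<longrightarrow> x = 0) \<longleftrightarrow> (\<forall>x. X *v x = 0 \<longrightarrow> x = 0)"
    by (auto simp flip: matrix_vector_mul_assoc)
  have "det (transpose X ** X) \<noteq> 0 \<longleftrightarrow> (\<forall>x. (transpose X ** X) *v x = 0 \<longrightarrow> x = 0)"
    unfolding invertible_det_nz[symmetric] invertible_left_inverse matrix_left_invertible_ker ..
  also have "\<dots> \<longleftrightarrow> inj ((*v) X)"
    unfolding ker matrix_left_invertible_ker[symmetric] matrix_left_invertible_injective ..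
  finally show ?thesis .
qed

text \<open>
  Choose an isometry of \<open>\<real>\<^sup>m\<close> onto the column space of \<open>X\<close>; its matrix is \<open>v\<close>, and \<open>T = v\<^sup>T X\<close>.
\<close>
lemma frame_decomposition:
  fixes X :: "real^'m^'n"
  assumes "det (transpose X ** X) \<noteq> 0"
  obtains v :: "real^'m^'n" and T :: "real^'m^'m"
  where "transpose v ** v = mat 1" "X = v ** T"
proof -
  have inj: "inj ((*v) X)"
    using assms by (simp add: gram_det_nonzero_iff)
  have sub: "subspace (range ((*v) X))"
    by (intro linear_subspace_image) auto
  have "dim (range ((*v) X)) = dim (UNIV :: (real^'m) set)"
    by (rule dim_image_eq) (use inj in auto)
  then have "dim (UNIV :: (real^'m) set) = dim (range ((*v) X))" ..
  then obtain f :: "real^'m \<Rightarrow> real^'n" where f: "linear f" "range f = range ((*v) X)" "\<And>x. norm (f x) = norm x"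
    by (rule isometries_subspaces[OF subspace_UNIV sub]) blast
  define v where "v = matrix f"
  have v: "v *v x = f x" for x
    using f(1) by (simp add: v_def matrix_works)
  have "f x \<bullet> f y = x \<bullet> y" for x y
    unfolding dot_norm linear_add[OF f(1), symmetric] f(3) ..
  then have vv: "(transpose v ** v) *v x = x" for x
  proof -
    have "y \<bullet> (transpose v *v (v *v x)) = y \<bullet> x" for y
      using \<open>\<And>x y. f x \<bullet> f y = x \<bullet> y\<close>[of y x] by (subst inner_transpose) (simp add: v)
    then show ?thesis
      by (metis vector_eq_ldot matrix_vector_mul_assoc)
  qed
  show ?thesis
  proof
    show "transpose v ** v = mat 1"
      using vv by (simp add: matrix_eq)
    show "X = v ** (transpose v ** X)"
    proof (subst matrix_eq, rule allI)
      fix x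
      obtain z where "X *v x = v *v z"
        using f(2) v by (metis UNIV_I image_iff)
      then show "X *v x = v ** (transpose v ** X) *v x"
        using vv[of z] by (simp add: matrix_vector_mul_assoc[symmetric])
    qed
  qed
qed

section \<open>Gram determinants by Gaussian elimination\<close>

lemma det_add_multiples_of_row:
  fixes A :: "real^'m^'m"
  shows "det (\<chi> a b. A $ a $ b + (if a = i then 0 else t a * A $ i $ b)) = det A"
proof -
  have "det (\<chi> a b. A $ a $ b + (if a \<in> K then t a * A $ i $ b else 0)) = det A"
    if "finite K" "i \<notin> K" for K
    using that
  proof (induction K rule: finite_induct)
    case empty
    then show ?case by (simp add: vec_lambda_eta)
  next
    case (insert c K)
    let ?B = "\<chi> a b. A $ a $ b + (if a \<in> K then t a * A $ i $ b else 0)"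
    have "(\<chi> a b. A $ a $ b + (if a \<in> insert c K then t a * A $ i $ b else 0)) =
        (\<chi> k. if k = c then row c ?B + t c *s row i ?B else row k ?B)"
      using insert.hyps insert.prems by (auto simp: vec_eq_iff row_def)
    then have "det (\<chi> a b. A $ a $ b + (if a \<in> insert c K then t a * A $ i $ b else 0)) =
        det (\<chi> k. if k = c then row c ?B + t c *s row i ?B else row k ?B)"
      by (simp only:)
    also have "\<dots> = det ?B"
      by (rule det_row_operation) (use insert.prems in auto)
    also have "\<dots> = det A"
      using insert.IH insert.prems by simp
    finally show ?case .
  qed
  from this[of "- {i}"]
  have "det (\<chi> a b. A $ a $ b + (if a \<in> - {i} then t a * A $ i $ b else 0)) = det A"
    by simp
  also have "(\<chi> a b. A $ a $ b + (if a \<in> - {i} then t a * A $ i $ b else 0)) =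
      (\<chi> a b. A $ a $ b + (if a = i then 0 else t a * A $ i $ b))"
    by (simp add: vec_eq_iff)
  finally show ?thesis .
qed

lemma det_add_multiples_of_column:
  fixes A :: "real^'m^'m"
  shows "det (\<chi> a b. A $ a $ b + (if b = i then 0 else t b * A $ a $ i)) = det A"
proof -
  have "transpose (\<chi> a b. A $ a $ b + (if b = i then 0 else t b * A $ a $ i)) =
      (\<chi> a b. transpose A $ a $ b + (if a = i then 0 else t a * transpose A $ i $ b))"
    by (simp add: transpose_def vec_eq_iff)
  then have "det (transpose (\<chi> a b. A $ a $ b + (if b = i then 0 else t b * A $ a $ i))) = det (transpose A)"
    by (simp only: det_add_multiples_of_row)
  then show ?thesis
    by (simp only: det_transpose)
qed

text \<open>
  The principal submatrix with index set \<open>J\<close>, filled up by the identity outside \<open>J\<close>.  This keeps the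
  matrix type while \<open>J\<close> grows, so that determinants of all sizes live in one type and induction over
  \<open>J\<close> is possible.
\<close>
definition padded_minor :: "'m set \<Rightarrow> ('m \<Rightarrow> 'm \<Rightarrow> real) \<Rightarrow> real^'m^'m"
  where "padded_minor J G = (\<chi> a b. if a \<in> J \<and> b \<in> J then G a b else if a = b then 1 else 0)"

text \<open>
  One step of Gaussian elimination with pivot \<open>G i i\<close>: clearing first the column and then the row of
  \<open>i\<close> leaves the Schur complement.
\<close>
lemma det_padded_minor_insert:
  fixes G :: "'m::finite \<Rightarrow> 'm \<Rightarrow> real"
  assumes i: "i \<notin> J" and G: "G i i \<noteq> 0"
  shows "det (padded_minor (insert i J) G) =
    G i i * det (padded_minor J (\<lambda>a b. G a b - G a i * G i b / G i i))"
proof -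
  let ?A = "padded_minor (insert i J) G"
  let ?R = "padded_minor J (\<lambda>a b. G a b - G a i * G i b / G i i)"
  define t where "t a = (if a \<in> J then - G a i / G i i else 0)" for a
  define s where "s b = (if b \<in> J then - G i b / G i i else 0)" for b
  define B where "B = (\<chi> a b. ?A $ a $ b + (if a = i then 0 else t a * ?A $ i $ b))"
  define C where "C = (\<chi> a b. B $ a $ b + (if b = i then 0 else s b * B $ a $ i))"
  have B: "B $ a $ b = (if a = i then ?A $ i $ b else if a \<in> J then
      ?A $ a $ b - G a i / G i i * ?A $ i $ b else ?A $ a $ b)" for a b
    using i by (simp add: B_def t_def)
  have Bi: "B $ a $ i = (if a = i then G i i else 0)" for a
    using i G by (simp add: B padded_minor_def)
  have "C $ a $ b = (if a = i then G i i *s (axis i 1) else ?R $ a) $ b" for a b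
  proof (cases "a = i")
    case True
    then show ?thesis
      using i G by (simp add: C_def Bi s_def) (simp add: B padded_minor_def axis_def)
  next
    case False
    then show ?thesis
      using i G by (simp add: C_def Bi) (simp add: B padded_minor_def)
  qed
  then have "C = (\<chi> a. if a = i then G i i *s (axis i 1) else ?R $ a)"
    by (simp add: vec_eq_iff)
  then have "det C = G i i * det (\<chi> a. if a = i then axis i 1 else ?R $ a)"
    using det_row_mul[of i "G i i" "\<lambda>_. axis i 1" "\<lambda>a. ?R $ a"] by simp
  also have "(\<chi> a. if a = i then axis i 1 else ?R $ a) = ?R"
    using i by (auto simp: vec_eq_iff padded_minor_def axis_def)
  finally have "det C = G i i * det ?R" .
  moreover have "det C = det B"
    unfolding C_def by (rule det_add_multiples_of_column)
  moreover have "det B = det ?A"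
    unfolding B_def by (rule det_add_multiples_of_row)
  ultimately show ?thesis
    by simp
qed

text \<open>
  The projection onto the orthogonal complement of \<open>P x\<close> in the range of \<open>P\<close>.  When \<open>P x = 0\<close> the
  quotient is 0 and \<open>P\<close> is returned.
\<close>
definition deflate :: "real^'n^'n \<Rightarrow> real^'n \<Rightarrow> real^'n^'n"
  where "deflate P x = (\<chi> i j. P $ i $ j - (P *v x) $ i * (P *v x) $ j / (norm (P *v x))\<^sup>2)"

lemma deflate_mult:
  "deflate P x *v z = P *v z - (((P *v x) \<bullet> z) / (norm (P *v x))\<^sup>2) *\<^sub>R (P *v x)"
proof -
  define y n where "y = P *v x" and "n = (norm y)\<^sup>2"
  have "(\<Sum>j\<in>UNIV. (P $ i $ j - y $ i * y $ j / n) * z $ j) =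
      (\<Sum>j\<in>UNIV. P $ i $ j * z $ j) - (\<Sum>j\<in>UNIV. y $ j * z $ j) / n * y $ i" for i
    by (simp add: left_diff_distrib sum_subtractf sum_divide_distrib sum_distrib_right)
       (simp add: mult_ac)
  then have "(deflate P x *v z) $ i = (P *v z) $ i - (y \<bullet> z) / n * y $ i" for i
    by (simp add: matrix_vector_mult_def[of _ z] inner_vec_def deflate_def flip: y_def n_def)
  then show ?thesis
    by (simp add: vec_eq_iff flip: y_def n_def)
qed

lemma orth_projection_deflate:
  assumes P: "orth_projection P" and x: "P *v x \<noteq> 0"
  shows "orth_projection (deflate P x)" "trace (deflate P x) = trace P - 1"
proof -
  define y where "y = P *v x"
  have y: "P *v y = y" "(norm y)\<^sup>2 \<noteq> 0"
    using x P by (simp_all add: y_def)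
  have sym: "P $ i $ j = P $ j $ i" for i j
  proof -
    have "transpose P $ j $ i = P $ j $ i"
      using P by (simp add: orth_projection_def)
    then show ?thesis
      by (simp add: transpose_def)
  qed
  have "transpose (deflate P x) = deflate P x"
  proof -
    have "transpose (deflate P x) $ i $ j = deflate P x $ i $ j" for i j
      using sym[of j i] by (simp add: deflate_def transpose_def mult.commute)
    then show ?thesis
      by (simp add: vec_eq_iff)
  qed
  moreover have "deflate P x *v (deflate P x *v z) = deflate P x *v z" for z
  proof -
    define w where "w = deflate P x *v z"
    have w: "w = P *v z - ((y \<bullet> z) / (norm y)\<^sup>2) *\<^sub>R y"
      by (simp add: w_def deflate_mult y_def)
    have "y \<bullet> (P *v z) = y \<bullet> z"
      by (simp add: orth_projection_inner[OF P] y(1))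
    then have "y \<bullet> w = 0"
      using y(2) by (simp add: w inner_diff_right power2_norm_eq_inner)
    moreover have "P *v w = w"
      by (simp add: w matrix_vector_mult_diff_distrib matrix_vector_mult_scaleR y(1) P)
    ultimately show ?thesis
      by (simp add: deflate_mult[of P x w] flip: y_def w_def)
  qed
  then have "deflate P x ** deflate P x = deflate P x"
    by (simp add: matrix_eq matrix_vector_mul_assoc[symmetric])
  ultimately show "orth_projection (deflate P x)"
    by (simp add: orth_projection_def)
  have "(\<Sum>i\<in>UNIV. y $ i * y $ i / (norm y)\<^sup>2) = 1"
    using y(2) by (simp add: power2_norm_eq_inner inner_vec_def flip: sum_divide_distrib)
  then show "trace (deflate P x) = trace P - 1"
    by (simp add: trace_def deflate_def sum_subtractf flip: y_def)
qed

section \<open>Moments of Gaussian Gram determinants\<close>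

lemma measurable_matrix_vector_mult [measurable]: "(\<lambda>x. A *v x) \<in> borel_measurable borel"
  for A :: "real^'n^'m"
  by (intro borel_measurable_continuous_onI linear_continuous_on) (simp add: linear_linear[symmetric])

text \<open>
  In coordinates that diagonalise \<open>P\<close>, the squared norm of \<open>P x\<close> is a sum of \<open>trace P\<close> squared
  coordinates, and the Gaussian measure looks the same in the new coordinates.
\<close>
lemma distr_gaussian_norm_projection:
  fixes P :: "real^'n^'n"
  assumes P: "orth_projection P" and pos: "trace P > 0"
  shows "distr gaussian borel (\<lambda>x. (norm (P *v x))\<^sup>2) =
    density lborel (\<lambda>r. ennreal (gamma_density (trace P / 2) r))"
proof (rule measure_eqI)
  obtain F S where F: "orthogonal_matrix F" and tr: "trace P = real (card S)"
    and nrm: "\<And>x. (norm (P *v x))\<^sup>2 = (\<Sum>i\<in>S. ((F *v x) $ i)\<^sup>2)"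
    by (rule orth_projection_diagonalize[OF P]) blast
  have S: "S \<noteq> {}"
    using tr pos by auto
  have ot: "orthogonal_transformation ((*v) F)"
    using F by (simp add: orthogonal_transformation_matrix matrix_vector_mul_linear)
  fix A :: "real set" assume "A \<in> sets (distr gaussian borel (\<lambda>x. (norm (P *v x))\<^sup>2))"
  then have A [measurable]: "A \<in> sets borel" by simp
  have "emeasure (distr gaussian borel (\<lambda>x. (norm (P *v x))\<^sup>2)) A =
      (\<integral>\<^sup>+r. indicator A r \<partial>distr gaussian borel (\<lambda>x. (norm (P *v x))\<^sup>2))"
    by simp
  also have "\<dots> = (\<integral>\<^sup>+x. indicator A (\<Sum>i\<in>S. ((F *v x) $ i)\<^sup>2) \<partial>gaussian)"
    by (subst nn_integral_distr, measurable) (simp_all add: nrm)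
  also have "\<dots> = (\<integral>\<^sup>+x. indicator A (\<Sum>i\<in>S. (x $ i)\<^sup>2) \<partial>(gaussian :: (real^'n) measure))"
    by (rule nn_integral_gaussian_orthogonal[OF ot]) measurable
  also have "\<dots> = (\<integral>\<^sup>+r. indicator A r * ennreal (gamma_density (real (card S) / 2) r) \<partial>lborel)"
    by (rule nn_integral_gaussian_sum_squares[OF S]) measurable
  also have "\<dots> = emeasure (density lborel (\<lambda>r. ennreal (gamma_density (trace P / 2) r))) A"
    by (simp add: emeasure_density tr mult.commute)
  finally show "emeasure (distr gaussian borel (\<lambda>x. (norm (P *v x))\<^sup>2)) A =
      emeasure (density lborel (\<lambda>r. ennreal (gamma_density (trace P / 2) r))) A" .
qed simp

definition gram_det :: "'m::finite set \<Rightarrow> real^'n^'n \<Rightarrow> ('m \<Rightarrow> real^'n) \<Rightarrow> real"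
  where "gram_det J P x = det (padded_minor J (\<lambda>a b. x a \<bullet> (P *v x b)))"

lemma gram_det_cong: "(\<And>a. a \<in> J \<Longrightarrow> x a = y a) \<Longrightarrow> gram_det J P x = gram_det J P y"
  by (simp add: gram_det_def padded_minor_def cong: if_cong)

lemma gram_det_empty [simp]: "gram_det {} P x = 1"
  by (simp add: gram_det_def padded_minor_def flip: mat_def)

text \<open>
  The Schur complement of the Gram matrix of \<open>P\<close> with respect to the vector \<open>x i\<close> is again a Gram
  matrix, namely that of the deflated projection.
\<close>
lemma gram_det_insert:
  assumes P: "orth_projection P" and i: "i \<notin> J"
  shows "gram_det (insert i J) P x = (norm (P *v x i))\<^sup>2 * gram_det J (deflate P (x i)) x"
proof (cases "P *v x i = 0")
  case True
  have "x i \<bullet> (P *v x b) = 0" for b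
    by (simp add: orth_projection_inner[OF P] True)
  then have "row i (padded_minor (insert i J) (\<lambda>a b. x a \<bullet> (P *v x b))) = 0"
    by (auto simp: vec_eq_iff row_def padded_minor_def)
  then show ?thesis
    using True det_zero_row(2) by (simp add: gram_det_def)
next
  case False
  have "x i \<bullet> (P *v x i) \<noteq> 0"
    using False by (simp add: orth_projection_inner_self[OF P])
  moreover have "x a \<bullet> (deflate P (x i) *v x b) =
      x a \<bullet> (P *v x b) - x a \<bullet> (P *v x i) * (x i \<bullet> (P *v x b)) / (x i \<bullet> (P *v x i))" for a b
    by (simp add: deflate_mult inner_diff_right orth_projection_inner_self[OF P])
       (simp add: orth_projection_inner[OF P])
  ultimately show ?thesis
    by (simp add: gram_det_def det_padded_minor_insert[OF i] orth_projection_inner_self[OF P])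
qed

lemma gram_det_measurable [measurable]:
  assumes "J \<subseteq> K"
  shows "gram_det J P \<in> borel_measurable (Pi\<^sub>M K (\<lambda>_. gaussian))"
proof -
  have "(\<lambda>x. if a \<in> J \<and> b \<in> J then x a \<bullet> (P *v x b) else if a = b then 1 else 0)
      \<in> borel_measurable (Pi\<^sub>M K (\<lambda>_. gaussian))" for a b
  proof (cases "a \<in> J \<and> b \<in> J")
    case True
    then have [measurable]: "(\<lambda>x. x a) \<in> borel_measurable (Pi\<^sub>M K (\<lambda>_. gaussian :: (real^'n) measure))"
      "(\<lambda>x. x b) \<in> borel_measurable (Pi\<^sub>M K (\<lambda>_. gaussian :: (real^'n) measure))"
      using assms measurable_component_singleton[of a K "\<lambda>_. gaussian"]
        measurable_component_singleton[of b K "\<lambda>_. gaussian"] by (auto cong: measurable_cong_sets)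
    show ?thesis
      using True by simp
  next
    case False
    show ?thesis
      unfolding if_not_P[OF False] by simp
  qed
  then show ?thesis
    unfolding gram_det_def[abs_def] det_def padded_minor_def by simp
qed

definition gamma_moment :: "real \<Rightarrow> real \<Rightarrow> ennreal"
  where "gamma_moment p s = (\<integral>\<^sup>+r. ennreal (r powr s) * ennreal (gamma_density p r) \<partial>lborel)"

text \<open>
  Integrate the column \<open>i\<close> last: for each value \<open>y\<close> of that column, the inner integral is the moment of
  the remaining Gram determinant for \<open>deflate P y\<close>, which is the same for all \<open>y\<close> with \<open>P y \<noteq> 0\<close> because
  it depends only on the rank.  The moments are therefore those of a product of independent Gamma
  variables with shapes \<open>(trace P - l) / 2\<close>.
\<close>
lemma nn_integral_gram_det:
  fixes P :: "real^'n^'n" and J :: "'m::finite set"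
  assumes "orth_projection P" "real (card J) \<le> trace P"
  shows "(\<integral>\<^sup>+x. ennreal (\<bar>gram_det J P x\<bar> powr s) \<partial>Pi\<^sub>M J (\<lambda>_. gaussian)) =
    (\<Prod>l<card J. gamma_moment ((trace P - real l) / 2) s)"
proof -
  interpret prob_space "gaussian :: (real^'n) measure" by (rule prob_space_gaussian)
  interpret product_sigma_finite "\<lambda>_::'m. gaussian :: (real^'n) measure"
    by standard
  have "finite J" by simp
  then show ?thesis using assms
  proof (induction J arbitrary: P rule: finite_induct)
    case empty
    show ?case
      by (simp add: PiM_empty)
  next
    case (insert i J)
    have tr: "trace P \<ge> 1 + real (card J)"
      using insert by simp
    let ?C = "\<Prod>l<card J. gamma_moment ((trace P - 1 - real l) / 2) s"
    have "(\<integral>\<^sup>+x. ennreal (\<bar>gram_det (insert i J) P x\<bar> powr s) \<partial>Pi\<^sub>M (insert i J) (\<lambda>_. gaussian)) =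
        (\<integral>\<^sup>+y. \<integral>\<^sup>+x. ennreal (\<bar>gram_det (insert i J) P (x(i := y))\<bar> powr s) \<partial>Pi\<^sub>M J (\<lambda>_. gaussian) \<partial>gaussian)"
      using insert.hyps by (intro product_nn_integral_insert_rev) measurable
    also have "\<dots> = (\<integral>\<^sup>+y. ennreal ((norm (P *v y))\<^sup>2 powr s) * ?C \<partial>gaussian)"
    proof (rule nn_integral_cong)
      fix y :: "real^'n"
      have eq: "gram_det (insert i J) P (x(i := y)) = (norm (P *v y))\<^sup>2 * gram_det J (deflate P y) x" for x
      proof -
        have "gram_det J (deflate P y) (x(i := y)) = gram_det J (deflate P y) x"
          using insert.hyps by (intro gram_det_cong) auto
        then show ?thesis
          using gram_det_insert[OF insert.prems(1) insert.hyps(2), of "x(i := y)"] by simp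
      qed
      show "(\<integral>\<^sup>+x. ennreal (\<bar>gram_det (insert i J) P (x(i := y))\<bar> powr s) \<partial>Pi\<^sub>M J (\<lambda>_. gaussian)) =
          ennreal ((norm (P *v y))\<^sup>2 powr s) * ?C"
      \<comment> \<open>In the degenerate case both sides vanish because \<open>0 powr s = 0\<close>.\<close>
      proof (cases "P *v y = 0")
        case False
        have "(\<integral>\<^sup>+x. ennreal (\<bar>gram_det (insert i J) P (x(i := y))\<bar> powr s) \<partial>Pi\<^sub>M J (\<lambda>_. gaussian)) =
          (\<integral>\<^sup>+x. ennreal ((norm (P *v y))\<^sup>2 powr s) * ennreal (\<bar>gram_det J (deflate P y) x\<bar> powr s)
            \<partial>Pi\<^sub>M J (\<lambda>_. gaussian))"
          by (simp add: eq abs_mult powr_mult ennreal_mult)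
        also have "\<dots> = ennreal ((norm (P *v y))\<^sup>2 powr s) *
            (\<integral>\<^sup>+x. ennreal (\<bar>gram_det J (deflate P y) x\<bar> powr s) \<partial>Pi\<^sub>M J (\<lambda>_. gaussian))"
          by (rule nn_integral_cmult) measurable
        also have "(\<integral>\<^sup>+x. ennreal (\<bar>gram_det J (deflate P y) x\<bar> powr s) \<partial>Pi\<^sub>M J (\<lambda>_. gaussian)) = ?C"
          using insert.IH[OF orth_projection_deflate(1)[OF insert.prems(1) False]]
            orth_projection_deflate(2)[OF insert.prems(1) False] tr by simp
        finally show ?thesis .
      qed (simp add: eq)
    qed
    also have "\<dots> = (\<integral>\<^sup>+y. ennreal ((norm (P *v y))\<^sup>2 powr s) \<partial>gaussian) * ?C"
      by (rule nn_integral_multc) measurable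
    also have "(\<integral>\<^sup>+y. ennreal ((norm (P *v y))\<^sup>2 powr s) \<partial>gaussian) =
        (\<integral>\<^sup>+r. ennreal (r powr s) \<partial>distr gaussian borel (\<lambda>y. (norm (P *v y))\<^sup>2))"
      by (subst nn_integral_distr) simp_all
    also have "\<dots> = gamma_moment (trace P / 2) s"
      using tr by (subst distr_gaussian_norm_projection[OF insert.prems(1)])
        (simp_all add: nn_integral_density gamma_moment_def mult.commute)
    also have "gamma_moment (trace P / 2) s * ?C =
        (\<Prod>l<card (insert i J). gamma_moment ((trace P - real l) / 2) s)"
      using insert.hyps by (simp add: prod.lessThan_Suc_shift diff_diff_eq del: prod.lessThan_Suc)
    finally show ?case .
  qed
qed

lemma gamma_moment_eq:
  assumes "p > 0" "p + s > 0"
  shows "gamma_moment p s = ennreal (Gamma (p + s) / Gamma p)"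
proof -
  have G: "Gamma p > 0" "Gamma (p + s) > 0"
    using assms by (auto intro: Gamma_real_pos)
  have "r powr s * gamma_density p r = Gamma (p + s) / Gamma p * gamma_density (p + s) r" for r
    using G by (cases "r > 0") (simp_all add: gamma_density_def field_simps flip: powr_add)
  then have "gamma_moment p s = (\<integral>\<^sup>+r. ennreal (Gamma (p + s) / Gamma p) * ennreal (gamma_density (p + s) r) \<partial>lborel)"
    unfolding gamma_moment_def using assms G
    by (intro nn_integral_cong) (simp add: gamma_density_nonneg flip: ennreal_mult')
  also have "\<dots> = ennreal (Gamma (p + s) / Gamma p)"
    using assms by (subst nn_integral_cmult) (simp_all add: nn_integral_gamma_density)
  finally show ?thesis .
qed

text \<open>
  Near 0 the integrand is at least \<open>c * r powr (e - 1)\<close> for every \<open>e > 0\<close>, whose integral over the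
  unit interval is \<open>c / e\<close>.
\<close>
lemma gamma_moment_infinite:
  assumes "p > 0" "p + s \<le> 0"
  shows "gamma_moment p s = \<infinity>"
proof -
  have G: "Gamma p > 0"
    using assms by (auto intro: Gamma_real_pos)
  define c where "c = exp (-1) / Gamma p"
  have c: "c > 0"
    using G by (simp add: c_def)
  have "ennreal (c / e) \<le> gamma_moment p s" if e: "e > 0" for e
  proof -
    have "((\<lambda>x. x powr (e - 1)) has_integral (1 powr (e - 1 + 1) / (e - 1 + 1))) {0..1}"
      using e by (intro has_integral_powr_from_0) auto
    then have "((\<lambda>x. c * x powr (e - 1)) has_integral c * (1 / e)) {0..1}"
      by (intro has_integral_mult_right) simp
    from nn_integral_has_integral_lebesgue'[OF _ this]
    have "ennreal (c / e) = (\<integral>\<^sup>+r. ennreal (c * r powr (e - 1)) * indicator {0..1} r \<partial>lborel)"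
      using c by simp
    also have "\<dots> \<le> gamma_moment p s"
      unfolding gamma_moment_def
    proof (rule nn_integral_mono)
      fix r :: real
      show "ennreal (c * r powr (e - 1)) * indicator {0..1} r \<le> ennreal (r powr s) * ennreal (gamma_density p r)"
      proof (cases "0 < r \<and> r \<le> 1")
        case True
        have "r powr (e - 1) \<le> r powr (s + (p - 1))"
          using True assms e by (intro powr_mono') auto
        moreover have "exp (-1) \<le> exp (- r)"
          using True by simp
        ultimately have "r powr (e - 1) * exp (-1) \<le> r powr (s + (p - 1)) * exp (- r)"
          by (intro mult_mono) auto
        also have "r powr (s + (p - 1)) = r powr s * r powr (p - 1)"
          by (rule powr_add)
        finally have "c * r powr (e - 1) \<le> r powr s * gamma_density p r"
          using True G by (simp add: c_def gamma_density_def divide_right_mono mult_ac)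
        then show ?thesis
          using True assms by (simp add: gamma_density_nonneg ennreal_leI flip: ennreal_mult')
      next
        case False
        then show ?thesis
          by (cases "r = 0") (auto simp: indicator_def)
      qed
    qed
    finally show ?thesis .
  qed
  note bound = this
  show ?thesis
  proof (rule ccontr)
    assume "gamma_moment p s \<noteq> \<infinity>"
    then obtain B where B: "gamma_moment p s = ennreal B" "B \<ge> 0"
      by (cases "gamma_moment p s") auto
    have "c / (c / (B + 1)) \<le> B"
      using bound[of "c / (B + 1)"] B c by simp
    then show False
      using c B by simp
  qed
qed

lemma gamma_moment_pos: "p > 0 \<Longrightarrow> gamma_moment p s \<noteq> 0"
  by (cases "p + s > 0") (auto simp: gamma_moment_eq gamma_moment_infinite ennreal_eq_0_iff
      not_le intro!: divide_pos_pos Gamma_real_pos)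


lemma norm_of_real_powr: "x \<ge> 0 \<Longrightarrow> norm (complex_of_real x powr z) = x powr Re z"
  by (cases "x = 0") (simp_all add: norm_powr_real_powr)

text \<open>
  On the real line the complex logarithm is \<open>ln x\<close> for positive and \<open>ln (- x) + \<i> \<pi>\<close> for negative
  arguments, so measurability follows from that of \<open>ln\<close>.
\<close>
lemma measurable_of_real_powr [measurable]:
  "(\<lambda>x. complex_of_real x powr z) \<in> borel_measurable borel"
proof -
  have eq: "complex_of_real x powr z = (if x = 0 then 0 else if x > 0 then exp (z * of_real (ln x))
      else exp (z * (of_real (ln (- x)) + \<i> * of_real pi)))" for x
  proof (cases x "0 :: real" rule: linorder_cases)
    case less
    then have "Ln (complex_of_real x) = of_real (ln (- x)) + \<i> * of_real pi"
      using Ln_minus[of "complex_of_real (- x)"] Ln_of_real[of "- x"] by (simp del: Ln_of_real)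
    then show ?thesis
      using less by (simp add: powr_def)
  qed (simp_all add: powr_def Ln_of_real)
  show ?thesis
    unfolding eq by measurable
qed

lemma lborel_integral_gamma_density_powr:
  assumes p: "p > 0" and z: "Re z + p > 0"
  shows "(\<integral>r. gamma_density p r *\<^sub>R (complex_of_real r powr z) \<partial>lborel) =
    Gamma (of_real p + z) / Gamma (of_real p)"
proof -
  define g where "g t = complex_of_real t powr (of_real p + z - 1) / of_real (exp t)" for t
  have G: "Gamma p > 0"
    using p by (rule Gamma_real_pos)
  have z': "Re (of_real p + z) > 0"
    using z by simp
  have "set_integrable lebesgue {0<..} g"
    unfolding g_def by (rule absolutely_integrable_Gamma_integral'[OF z'])
  then have "(LINT t:{0<..}|lebesgue. g t) = integral {0<..} g"
    by (rule set_lebesgue_integral_eq_integral)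
  also have "\<dots> = Gamma (of_real p + z)"
    unfolding g_def by (rule integral_unique[OF Gamma_integral_complex'[OF z']])
  finally have "(LINT t:{0<..}|lebesgue. g t) = Gamma (of_real p + z)" .
  then have *: "(\<integral>t. indicator {0<..} t *\<^sub>R g t \<partial>lborel) = Gamma (of_real p + z)"
    unfolding set_lebesgue_integral_def
    by (subst (asm) integral_completion) (simp_all add: g_def)
  have "gamma_density p r *\<^sub>R (complex_of_real r powr z) =
      (indicator {0<..} r *\<^sub>R g r) / of_real (Gamma p)" for r
  proof (cases "r > 0")
    case True
    have "complex_of_real r powr (of_real p + z - 1) = complex_of_real r powr z * complex_of_real r powr of_real (p - 1)"
      by (simp add: algebra_simps flip: powr_add)
    also have "complex_of_real r powr of_real (p - 1) = of_real (r powr (p - 1))"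
      using True by (intro powr_of_real) simp
    finally show ?thesis
      using True G by (simp add: gamma_density_def g_def scaleR_conv_of_real exp_minus field_simps)
  qed (simp add: gamma_density_def)
  then have "(\<integral>r. gamma_density p r *\<^sub>R (complex_of_real r powr z) \<partial>lborel) =
      (\<integral>r. (indicator {0<..} r *\<^sub>R g r) / of_real (Gamma p) \<partial>lborel)"
    by simp
  also have "\<dots> = Gamma (of_real p + z) / of_real (Gamma p)"
    by (simp add: *)
  finally show ?thesis
    by (simp add: Gamma_complex_of_real)
qed

lemma of_real_mult_powr:
  "x \<ge> 0 \<Longrightarrow> y \<ge> 0 \<Longrightarrow> complex_of_real (x * y) powr z = of_real x powr z * of_real y powr z"
  by (simp add: powr_times_real)

lemma integrable_gram_det_powr:
  fixes P :: "real^'n^'n" and J :: "'m::finite set"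
  assumes P: "orth_projection P" "real (card J) \<le> trace P"
    and z: "\<And>l. l < card J \<Longrightarrow> Re z + (trace P - real l) / 2 > 0"
  shows "integrable (Pi\<^sub>M J (\<lambda>_. gaussian)) (\<lambda>x. complex_of_real \<bar>gram_det J P x\<bar> powr z)"
proof (rule integrableI_bounded)
  have "(\<integral>\<^sup>+x. ennreal (norm (complex_of_real \<bar>gram_det J P x\<bar> powr z)) \<partial>Pi\<^sub>M J (\<lambda>_. gaussian)) =
      (\<Prod>l<card J. gamma_moment ((trace P - real l) / 2) (Re z))"
    by (simp add: norm_of_real_powr nn_integral_gram_det[OF P])
  also have "\<dots> = (\<Prod>l<card J. ennreal (Gamma ((trace P - real l) / 2 + Re z) / Gamma ((trace P - real l) / 2)))"
    using P z by (intro prod.cong refl gamma_moment_eq) (auto simp: add.commute)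
  also have "\<dots> = ennreal (\<Prod>l<card J. Gamma ((trace P - real l) / 2 + Re z) / Gamma ((trace P - real l) / 2))"
  proof (rule prod_ennreal)
    fix l assume "l \<in> {..<card J}"
    then have "Gamma ((trace P - real l) / 2 + Re z) > 0" "Gamma ((trace P - real l) / 2) > 0"
      using P z[of l] by (auto intro!: Gamma_real_pos simp: add.commute)
    then show "Gamma ((trace P - real l) / 2 + Re z) / Gamma ((trace P - real l) / 2) \<ge> 0"
      by simp
  qed
  also have "\<dots> < \<infinity>"
    by simp
  finally show "(\<integral>\<^sup>+x. ennreal (norm (complex_of_real \<bar>gram_det J P x\<bar> powr z)) \<partial>Pi\<^sub>M J (\<lambda>_. gaussian)) < \<infinity>" .
qed measurable

text \<open>
  The recursion of \<open>nn_integral_gram_det\<close> for complex exponents; absolute convergence, which the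
  exchange of integrals requires, is supplied by the real moments.
\<close>
lemma integral_gram_det_powr:
  fixes P :: "real^'n^'n" and J :: "'m::finite set"
  assumes P: "orth_projection P" "real (card J) \<le> trace P"
    and z: "\<And>l. l < card J \<Longrightarrow> Re z + (trace P - real l) / 2 > 0"
  shows "(\<integral>x. complex_of_real \<bar>gram_det J P x\<bar> powr z \<partial>Pi\<^sub>M J (\<lambda>_. gaussian)) =
    (\<Prod>l<card J. Gamma (of_real ((trace P - real l) / 2) + z) / Gamma (of_real ((trace P - real l) / 2)))"
proof -
  interpret prob_space "gaussian :: (real^'n) measure" by (rule prob_space_gaussian)
  interpret product_sigma_finite "\<lambda>_::'m. gaussian :: (real^'n) measure"
    by standard
  have "finite J" by simp
  then show ?thesis using assms
  proof (induction J arbitrary: P rule: finite_induct)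
    case empty
    show ?case
      by (simp add: PiM_empty)
  next
    case (insert i J)
    have tr: "trace P \<ge> 1 + real (card J)"
      using insert by simp
    let ?C = "\<Prod>l<card J. Gamma (of_real ((trace P - 1 - real l) / 2) + z) /
      Gamma (complex_of_real ((trace P - 1 - real l) / 2))"
    have "(\<integral>x. complex_of_real \<bar>gram_det (insert i J) P x\<bar> powr z \<partial>Pi\<^sub>M ({i} \<union> J) (\<lambda>_. gaussian)) =
        (\<integral>w. (\<integral>x. complex_of_real \<bar>gram_det (insert i J) P (merge {i} J (w, x))\<bar> powr z
          \<partial>Pi\<^sub>M J (\<lambda>_. gaussian)) \<partial>Pi\<^sub>M {i} (\<lambda>_. gaussian))"
      using insert.hyps integrable_gram_det_powr[OF insert.prems]
      by (intro product_integral_fold) auto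
    also have "\<dots> = (\<integral>w. complex_of_real ((norm (P *v w i))\<^sup>2) powr z * ?C \<partial>Pi\<^sub>M {i} (\<lambda>_. gaussian))"
    proof (rule Bochner_Integration.integral_cong)
      fix w :: "'m \<Rightarrow> real^'n"
      have eq: "gram_det (insert i J) P (merge {i} J (w, x)) =
          (norm (P *v w i))\<^sup>2 * gram_det J (deflate P (w i)) x" for x
      proof -
        have "gram_det J (deflate P (w i)) (merge {i} J (w, x)) = gram_det J (deflate P (w i)) x"
          using insert.hyps by (intro gram_det_cong) (auto simp: merge_def)
        then show ?thesis
          using gram_det_insert[OF insert.prems(1) insert.hyps(2), of "merge {i} J (w, x)"]
          by (simp add: merge_def)
      qed
      show "(\<integral>x. complex_of_real \<bar>gram_det (insert i J) P (merge {i} J (w, x))\<bar> powr z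
          \<partial>Pi\<^sub>M J (\<lambda>_. gaussian)) = complex_of_real ((norm (P *v w i))\<^sup>2) powr z * ?C"
      proof (cases "P *v w i = 0")
        case False
        have z': "Re z + (trace (deflate P (w i)) - real l) / 2 > 0" if "l < card J" for l
          using insert.prems(3)[of "Suc l"] that insert.hyps
          by (simp add: orth_projection_deflate(2)[OF insert.prems(1) False] algebra_simps)
        have "(\<integral>x. complex_of_real \<bar>gram_det J (deflate P (w i)) x\<bar> powr z \<partial>Pi\<^sub>M J (\<lambda>_. gaussian)) = ?C"
          using insert.IH[OF orth_projection_deflate(1)[OF insert.prems(1) False] _ z']
            orth_projection_deflate(2)[OF insert.prems(1) False] tr by simp
        moreover have "complex_of_real \<bar>gram_det (insert i J) P (merge {i} J (w, x))\<bar> powr z =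
            complex_of_real ((norm (P *v w i))\<^sup>2) powr z *
            complex_of_real \<bar>gram_det J (deflate P (w i)) x\<bar> powr z" for x
          by (subst of_real_mult_powr[symmetric]) (simp_all add: eq abs_mult)
        ultimately show ?thesis
          by simp
      qed (simp add: eq)
    qed simp
    also have "\<dots> = (\<integral>w. complex_of_real ((norm (P *v w i))\<^sup>2) powr z \<partial>Pi\<^sub>M {i} (\<lambda>_. gaussian)) * ?C"
      by (rule integral_mult_left_zero)
    also have "(\<integral>w. complex_of_real ((norm (P *v w i))\<^sup>2) powr z \<partial>Pi\<^sub>M {i} (\<lambda>_. gaussian)) =
        (\<integral>y. complex_of_real ((norm (P *v y))\<^sup>2) powr z \<partial>gaussian)"
      by (rule product_integral_singleton) measurable
    also have "\<dots> = (\<integral>r. complex_of_real r powr z \<partial>distr gaussian borel (\<lambda>y. (norm (P *v y))\<^sup>2))"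
      by (subst integral_distr) simp_all
    also have "\<dots> = (\<integral>r. gamma_density (trace P / 2) r *\<^sub>R (complex_of_real r powr z) \<partial>lborel)"
      using tr by (subst distr_gaussian_norm_projection[OF insert.prems(1)], simp, subst integral_density)
        (simp_all add: gamma_density_nonneg)
    also have "\<dots> = Gamma (of_real (trace P / 2) + z) / Gamma (of_real (trace P / 2))"
      using tr insert.prems(3)[of 0] insert.hyps
      by (intro lborel_integral_gamma_density_powr) auto
    also have "\<dots> * ?C = (\<Prod>l<card (insert i J). Gamma (of_real ((trace P - real l) / 2) + z) /
        Gamma (complex_of_real ((trace P - real l) / 2)))"
      using insert.hyps by (simp add: prod.lessThan_Suc_shift diff_diff_eq del: prod.lessThan_Suc)
    finally show ?case by simp
  qed
qed

section \<open>Kernels on the Stiefel manifold\<close>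

lemma measurable_matrixI:
  fixes f :: "'a \<Rightarrow> real^'m^'n"
  assumes "\<And>i j. (\<lambda>x. f x $ i $ j) \<in> borel_measurable M"
  shows "f \<in> borel_measurable M"
  using assms by (subst borel_measurable_euclidean_space) (auto simp: Basis_vec_def inner_axis)

lemma measurable_matrix_entry [measurable (raw)]:
  fixes f :: "'a \<Rightarrow> real^'m^'n"
  assumes "f \<in> borel_measurable M"
  shows "(\<lambda>x. f x $ i $ j) \<in> borel_measurable M"
  using assms by (rule measurable_compose) (intro borel_measurable_continuous_onI continuous_intros)

lemma measurable_matrix_mult [measurable (raw)]:
  fixes f :: "'a \<Rightarrow> real^'k^'n" and g :: "'a \<Rightarrow> real^'m^'k"
  assumes [measurable]: "f \<in> borel_measurable M" "g \<in> borel_measurable M"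
  shows "(\<lambda>x. f x ** g x) \<in> borel_measurable M"
  by (rule measurable_matrixI) (simp add: matrix_matrix_mult_def)

lemma measurable_transpose [measurable (raw)]:
  fixes f :: "'a \<Rightarrow> real^'m^'n"
  assumes [measurable]: "f \<in> borel_measurable M"
  shows "(\<lambda>x. transpose (f x)) \<in> borel_measurable M"
  by (rule measurable_matrixI) (simp add: transpose_def)

lemma measurable_det [measurable (raw)]:
  fixes f :: "'a \<Rightarrow> real^'m^'m"
  assumes [measurable]: "f \<in> borel_measurable M"
  shows "(\<lambda>x. det (f x)) \<in> borel_measurable M"
  unfolding det_def by simp

lemma orthogonal_matrix_mult_stiefel:
  "orthogonal_matrix Q \<Longrightarrow> v \<in> stiefel \<Longrightarrow> Q ** v \<in> stiefel" for v :: "real^'l^'n"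
proof -
  assume "orthogonal_matrix Q" "v \<in> stiefel"
  then have "transpose v ** (transpose Q ** Q) ** v = mat 1"
    by (simp add: stiefel_def orthogonal_matrix_def)
  then show ?thesis
    by (simp add: stiefel_def matrix_transpose_mul matrix_mul_assoc)
qed

context
  fixes M :: "(real^'m^'n) measure"
  assumes M: "invariant_stiefel_measure M"
begin

lemma stiefel_prob_space: "prob_space M"
  using M by (simp add: invariant_stiefel_measure_def)

lemma space_stiefel_measure: "space M = stiefel"
  using M sets_eq_imp_space_eq[of M "restrict_space borel stiefel"]
  by (simp add: invariant_stiefel_measure_def space_restrict_space)

lemma measurable_stiefel_embed: "(\<lambda>v. v) \<in> borel_measurable M"
proof -
  have "sets M = sets (restrict_space borel stiefel)"
    using M by (simp add: invariant_stiefel_measure_def)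
  then show ?thesis
    by (subst measurable_cong_sets[OF _ refl]) (auto intro: measurable_restrict_space1)
qed

lemma measurable_stiefel_rotate:
  assumes "orthogonal_matrix Q"
  shows "(\<lambda>v. Q ** v) \<in> M \<rightarrow>\<^sub>M M"
proof -
  note [measurable] = measurable_stiefel_embed
  have "sets M = sets (restrict_space borel stiefel)"
    using M by (simp add: invariant_stiefel_measure_def)
  moreover have "(\<lambda>v. Q ** v) \<in> M \<rightarrow>\<^sub>M restrict_space borel stiefel"
    by (rule measurable_restrict_space2)
      (auto simp: space_stiefel_measure orthogonal_matrix_mult_stiefel[OF assms])
  ultimately show ?thesis
    by (subst measurable_cong_sets[OF refl]) auto
qed

lemma distr_stiefel_rotate:
  assumes Q: "orthogonal_matrix Q" and [measurable]: "g \<in> M \<rightarrow>\<^sub>M N"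
  shows "distr M N (\<lambda>v. g (Q ** v)) = distr M N g"
proof -
  have "distr M N g = distr (distr M M (\<lambda>v. Q ** v)) N g"
    using M Q by (simp add: invariant_stiefel_measure_def)
  also have "\<dots> = distr M N (\<lambda>v. g (Q ** v))"
    by (subst distr_distr) (use measurable_stiefel_rotate[OF Q] in \<open>simp_all add: o_def\<close>)
  finally show ?thesis ..
qed

end

definition gram_kernel :: "real^'n^'n \<Rightarrow> real^'m^'n \<Rightarrow> real"
  where "gram_kernel P X = \<bar>det (transpose X ** P ** X)\<bar>"

lemma gram_kernel_nonneg [simp]: "gram_kernel P X \<ge> 0"
  by (simp add: gram_kernel_def)

lemma measurable_gram_kernel [measurable (raw)]:
  "P \<in> borel_measurable M \<Longrightarrow> X \<in> borel_measurable M \<Longrightarrow>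
    (\<lambda>x. gram_kernel (P x) (X x)) \<in> borel_measurable M"
  unfolding gram_kernel_def by measurable

lemma gram_kernel_mult: "gram_kernel P (X ** T) = (det T)\<^sup>2 * gram_kernel P X"
proof -
  have "transpose (X ** T) ** P ** (X ** T) = transpose T ** (transpose X ** P ** X) ** T"
    by (simp add: matrix_transpose_mul matrix_mul_assoc)
  then show ?thesis
    by (simp add: gram_kernel_def det_mul abs_mult power2_eq_square mult_ac)
qed

lemma gram_kernel_rotate:
  assumes "orthogonal_matrix F"
  shows "gram_kernel (F ** P ** transpose F) (F ** X) = gram_kernel P X"
proof -
  have F: "transpose F ** F = mat 1"
    using assms by (simp add: orthogonal_matrix_def)
  have "transpose (F ** X) ** (F ** P ** transpose F) ** (F ** X) =
      transpose X ** (transpose F ** F) ** P ** (transpose F ** F) ** X"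
    by (simp only: matrix_transpose_mul matrix_mul_assoc)
  then show ?thesis
    by (simp add: gram_kernel_def F)
qed

text \<open>
  If \<open>X\<close> is not injective then neither is \<open>X\<^sup>T P X\<close>.
\<close>
lemma gram_kernel_singular:
  fixes X :: "real^'m^'n"
  assumes "gram_kernel (mat 1) X = 0"
  shows "gram_kernel P X = 0"
proof -
  have "\<not> inj ((*v) X)"
    using assms gram_det_nonzero_iff[of X] by (simp add: gram_kernel_def)
  then obtain x y where "x \<noteq> y" "X *v x = X *v y"
    by (auto simp: inj_def)
  then have "(transpose X ** P ** X) *v x = (transpose X ** P ** X) *v y"
    by (simp add: matrix_vector_mul_assoc[symmetric])
  then have "\<not> inj ((*v) (transpose X ** P ** X))"
    using \<open>x \<noteq> y\<close> by (auto simp: inj_def)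
  then show ?thesis
    unfolding gram_kernel_def abs_eq_0
    by (metis invertible_det_nz invertible_left_inverse matrix_left_invertible_injective)
qed

lemma gram_kernel_id_frame:
  assumes "v \<in> stiefel" shows "gram_kernel (mat 1) v = 1"
  using assms by (simp add: gram_kernel_def stiefel_def)

lemma gram_entry: "(transpose X ** P ** X) $ a $ b = column a X \<bullet> (P *v column b X)"
  for X :: "real^'m^'n"
proof -
  have "(transpose X ** P ** X) $ a $ b = axis a 1 \<bullet> ((transpose X ** P ** X) *v axis b 1)"
    by (simp add: inner_axis' matrix_vector_mult_basis column_def)
  also have "\<dots> = axis a 1 \<bullet> (transpose X *v (P *v (X *v axis b 1)))"
    by (simp add: matrix_vector_mul_assoc[symmetric])
  also have "\<dots> = column a X \<bullet> (P *v column b X)"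
    by (subst inner_transpose) (simp add: matrix_vector_mult_basis)
  finally show ?thesis .
qed

lemma gram_kernel_columns: "gram_kernel P (\<chi> i a. x a $ i) = \<bar>gram_det UNIV P x\<bar>"
proof -
  have "transpose (\<chi> i a. x a $ i) ** P ** (\<chi> i a. x a $ i) = padded_minor UNIV (\<lambda>a b. x a \<bullet> (P *v x b))"
    by (simp add: vec_eq_iff padded_minor_def gram_entry column_def vec_lambda_eta)
  then show ?thesis
    by (simp add: gram_kernel_def gram_det_def)
qed

text \<open>
  The true bound is 1.  Any bound that is independent of \<open>P\<close> serves here, and expanding the determinant
  of a matrix with entries in \<open>[-1, 1]\<close> over permutations gives one at once.
\<close>
lemma gram_kernel_le:
  fixes v :: "real^'m^'n"
  assumes v: "v \<in> stiefel" and P: "orth_projection P"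
  shows "gram_kernel P v \<le> fact CARD('m)"
proof -
  let ?A = "transpose v ** P ** v"
  have unit: "norm (column c v) = 1" for c
    using v norm_orthonormal_frame[of v "axis c 1"] by (simp add: stiefel_def matrix_vector_mult_basis)
  have entry: "\<bar>?A $ a $ b\<bar> \<le> 1" for a b
  proof -
    have "\<bar>?A $ a $ b\<bar> \<le> norm (column a v) * norm (P *v column b v)"
      by (simp add: gram_entry Cauchy_Schwarz_ineq2)
    also have "\<dots> \<le> norm (column a v) * norm (column b v)"
      by (intro mult_left_mono orth_projection_norm_le[OF P] norm_ge_zero)
    also have "\<dots> = 1"
      by (simp add: unit)
    finally show ?thesis .
  qed
  have "\<bar>det ?A\<bar> \<le> (\<Sum>p | p permutes (UNIV :: 'm set). \<bar>of_int (sign p) * (\<Prod>i\<in>UNIV. ?A $ i $ p i)\<bar>)"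
    unfolding det_def by (rule sum_abs)
  also have "\<dots> \<le> (\<Sum>p | p permutes (UNIV :: 'm set). 1)"
  proof (rule sum_mono)
    fix p :: "'m \<Rightarrow> 'm"
    have "\<bar>of_int (sign p) * (\<Prod>i\<in>UNIV. ?A $ i $ p i)\<bar> = (\<Prod>i\<in>UNIV. \<bar>?A $ i $ p i\<bar>)"
      by (simp add: abs_mult abs_prod sign_def)
    also have "\<dots> \<le> 1"
      by (rule prod_le_1) (use entry in auto)
    finally show "\<bar>of_int (sign p) * (\<Prod>i\<in>UNIV. ?A $ i $ p i)\<bar> \<le> 1" .
  qed
  also have "\<dots> = fact CARD('m)"
    by (simp add: card_permutations)
  finally show ?thesis
    by (simp add: gram_kernel_def)
qed

section \<open>Integrals of the kernels\<close>

definition gaussian_columns :: "('m::finite \<Rightarrow> real^'n) measure"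
  where "gaussian_columns = Pi\<^sub>M UNIV (\<lambda>_. gaussian)"

lemma prob_space_gaussian_columns: "prob_space (gaussian_columns :: ('m::finite \<Rightarrow> real^'n) measure)"
  unfolding gaussian_columns_def by (intro prob_space_PiM prob_space_gaussian)

lemma measurable_columns [measurable]:
  "(\<lambda>x. \<chi> i a. x a $ i) \<in> borel_measurable (gaussian_columns :: ('m::finite \<Rightarrow> real^'n) measure)"
proof (rule measurable_matrixI)
  fix i a
  have [measurable]: "(\<lambda>x. x a) \<in> borel_measurable (gaussian_columns :: ('m::finite \<Rightarrow> real^'n) measure)"
    using measurable_component_singleton[of a UNIV "\<lambda>_. gaussian :: (real^'n) measure"]
    by (simp add: gaussian_columns_def cong: measurable_cong_sets)
  have [measurable]: "(\<lambda>y. y $ i) \<in> borel_measurable (borel :: (real^'n) measure)"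
    by (intro borel_measurable_continuous_onI continuous_intros)
  show "(\<lambda>x. (\<chi> i a. x a $ i) $ i $ a) \<in> borel_measurable (gaussian_columns :: ('m::finite \<Rightarrow> real^'n) measure)"
    by simp
qed

text \<open>
  The common setting of the two transforms: an \<open>O(n)\<close>-equivariant assignment of an orthogonal
  projection of rank \<open>r\<close> to each frame.  The range of \<open>u\<close> and its orthogonal complement are the two
  instances.
\<close>
locale projection_family =
  fixes \<nu> :: "(real^'k^'n) measure" and proj :: "real^'k^'n \<Rightarrow> real^'n^'n" and r :: nat
  assumes invariant: "invariant_stiefel_measure \<nu>"
    and orth_projection_proj: "u \<in> stiefel \<Longrightarrow> orth_projection (proj u)"
    and trace_proj: "u \<in> stiefel \<Longrightarrow> trace (proj u) = real r"
    and proj_rotate: "orthogonal_matrix F \<Longrightarrow> u \<in> stiefel \<Longrightarrow> proj (F ** u) = F ** proj u ** transpose F"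
    and measurable_proj: "proj \<in> borel_measurable borel"
    and r_less: "r < CARD('n)"
begin

sublocale prob_space \<nu>
  using invariant by (rule stiefel_prob_space)

lemma sigma_finite_nu: "sigma_finite_measure \<nu>"
  using stiefel_prob_space[OF invariant] by (rule prob_space_imp_sigma_finite)

lemma space_nu: "space \<nu> = stiefel"
  using invariant by (rule space_stiefel_measure)

lemma measurable_proj_nu [measurable]: "proj \<in> borel_measurable \<nu>"
  using measurable_compose[OF measurable_stiefel_embed[OF invariant] measurable_proj] .

text \<open>
  Some orthogonal matrix moves \<open>v\<close> to \<open>w\<close>; by equivariance it can be shifted to \<open>u\<close>, where the
  invariance of \<open>\<nu>\<close> absorbs it.  Stated for distributions, this serves real and complex
  exponents alike.
\<close>
lemma distr_kernel_frame:
  fixes v w :: "real^'m^'n"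
  assumes "v \<in> stiefel" "w \<in> stiefel"
  shows "distr \<nu> borel (\<lambda>u. gram_kernel (proj u) v) = distr \<nu> borel (\<lambda>u. gram_kernel (proj u) w)"
proof -
  obtain F where F: "orthogonal_matrix F" "F ** v = w"
    using assms orthogonal_matrix_transitive_on_frames[of v w] by (auto simp: stiefel_def)
  have "gram_kernel (proj (F ** u)) w = gram_kernel (proj u) v" if "u \<in> stiefel" for u
    unfolding F(2)[symmetric] using that F(1) by (simp add: proj_rotate gram_kernel_rotate)
  then have "distr \<nu> borel (\<lambda>u. gram_kernel (proj u) v) =
      distr \<nu> borel (\<lambda>u. gram_kernel (proj (F ** u)) w)"
    by (intro distr_cong) (simp_all add: space_nu)
  also have "\<dots> = distr \<nu> borel (\<lambda>u. gram_kernel (proj u) w)"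
    by (rule distr_stiefel_rotate[OF invariant F(1)]) measurable
  finally show ?thesis .
qed

text \<open>
  The mirror image of \<open>distr_kernel_frame\<close>, with the roles of \<open>u\<close> and \<open>v\<close> exchanged.
\<close>
lemma distr_kernel_base:
  fixes \<mu> :: "(real^'m^'n) measure"
  assumes \<mu>: "invariant_stiefel_measure \<mu>" and "u \<in> stiefel" "w \<in> stiefel"
  shows "distr \<mu> borel (\<lambda>v. gram_kernel (proj u) v) = distr \<mu> borel (\<lambda>v. gram_kernel (proj w) v)"
proof -
  note [measurable] = measurable_stiefel_embed[OF \<mu>]
  obtain F where F: "orthogonal_matrix F" "F ** u = w"
    using assms orthogonal_matrix_transitive_on_frames[of u w] by (auto simp: stiefel_def)
  have "gram_kernel (proj w) (F ** v) = gram_kernel (proj u) v" for v :: "real^'m^'n"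
    unfolding F(2)[symmetric] using assms(2) F(1) by (simp add: proj_rotate gram_kernel_rotate)
  then have "distr \<mu> borel (\<lambda>v. gram_kernel (proj u) v) = distr \<mu> borel (\<lambda>v. gram_kernel (proj w) (F ** v))"
    by simp
  also have "\<dots> = distr \<mu> borel (\<lambda>v. gram_kernel (proj w) v)"
    by (rule distr_stiefel_rotate[OF \<mu> F(1)]) measurable
  finally show ?thesis .
qed

text \<open>
  For \<open>X = w T\<close> with a frame \<open>w\<close>, the factor \<open>(det T)\<^sup>2\<close> of the kernel does not depend on \<open>u\<close> and equals
  the Gram determinant of \<open>X\<close>; for singular \<open>X\<close> both sides are 0.
\<close>
lemma nn_integral_kernel_columns:
  fixes X v :: "real^'m^'n"
  assumes v: "v \<in> stiefel"
  shows "(\<integral>\<^sup>+u. ennreal (gram_kernel (proj u) X powr s) \<partial>\<nu>) =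
    ennreal (gram_kernel (mat 1) X powr s) * (\<integral>\<^sup>+u. ennreal (gram_kernel (proj u) v powr s) \<partial>\<nu>)"
proof (cases "gram_kernel (mat 1) X = 0")
  case True
  then show ?thesis
    by (simp add: gram_kernel_singular)
next
  case False
  then obtain w :: "real^'m^'n" and T where w: "w \<in> stiefel" "X = w ** T"
    using frame_decomposition[of X] by (auto simp: gram_kernel_def stiefel_def)
  have "(\<integral>\<^sup>+u. ennreal (gram_kernel (proj u) w powr s) \<partial>\<nu>) =
      (\<integral>\<^sup>+r. ennreal (r powr s) \<partial>distr \<nu> borel (\<lambda>u. gram_kernel (proj u) w))"
    by (subst nn_integral_distr) simp_all
  also have "\<dots> = (\<integral>\<^sup>+u. ennreal (gram_kernel (proj u) v powr s) \<partial>\<nu>)"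
    by (subst distr_kernel_frame[OF w(1) v], subst nn_integral_distr) simp_all
  finally have eq: "(\<integral>\<^sup>+u. ennreal (gram_kernel (proj u) w powr s) \<partial>\<nu>) =
      (\<integral>\<^sup>+u. ennreal (gram_kernel (proj u) v powr s) \<partial>\<nu>)" .
  have "(\<integral>\<^sup>+u. ennreal (gram_kernel (proj u) X powr s) \<partial>\<nu>) =
      (\<integral>\<^sup>+u. ennreal ((det T)\<^sup>2 powr s) * ennreal (gram_kernel (proj u) w powr s) \<partial>\<nu>)"
    by (simp add: w gram_kernel_mult powr_mult ennreal_mult)
  also have "\<dots> = ennreal ((det T)\<^sup>2 powr s) * (\<integral>\<^sup>+u. ennreal (gram_kernel (proj u) w powr s) \<partial>\<nu>)"
    by (rule nn_integral_cmult) measurable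
  finally show ?thesis
    by (simp add: eq) (simp add: w gram_kernel_mult gram_kernel_id_frame)
qed

lemma integral_kernel_columns:
  fixes X v :: "real^'m^'n"
  assumes v: "v \<in> stiefel"
  shows "(\<integral>u. of_real (gram_kernel (proj u) X) powr z \<partial>\<nu>) =
    of_real (gram_kernel (mat 1) X) powr z * (\<integral>u. complex_of_real (gram_kernel (proj u) v) powr z \<partial>\<nu>)"
proof (cases "gram_kernel (mat 1) X = 0")
  case True
  then show ?thesis
    by (simp add: gram_kernel_singular)
next
  case False
  then obtain w :: "real^'m^'n" and T where w: "w \<in> stiefel" "X = w ** T"
    using frame_decomposition[of X] by (auto simp: gram_kernel_def stiefel_def)
  have "(\<integral>u. complex_of_real (gram_kernel (proj u) w) powr z \<partial>\<nu>) =
      (\<integral>r. complex_of_real r powr z \<partial>distr \<nu> borel (\<lambda>u. gram_kernel (proj u) w))"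
    by (subst integral_distr) simp_all
  also have "\<dots> = (\<integral>u. complex_of_real (gram_kernel (proj u) v) powr z \<partial>\<nu>)"
    by (subst distr_kernel_frame[OF w(1) v], subst integral_distr) simp_all
  finally have eq: "(\<integral>u. complex_of_real (gram_kernel (proj u) w) powr z \<partial>\<nu>) =
      (\<integral>u. complex_of_real (gram_kernel (proj u) v) powr z \<partial>\<nu>)" .
  have "(\<integral>u. of_real (gram_kernel (proj u) X) powr z \<partial>\<nu>) =
      (\<integral>u. of_real ((det T)\<^sup>2) powr z * of_real (gram_kernel (proj u) w) powr z \<partial>\<nu>)"
    unfolding w(2) gram_kernel_mult by (simp only: of_real_mult_powr zero_le_power2 gram_kernel_nonneg)
  also have "\<dots> = of_real ((det T)\<^sup>2) powr z * (\<integral>u. of_real (gram_kernel (proj u) w) powr z \<partial>\<nu>)"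
    by (rule integral_mult_right_zero)
  finally show ?thesis
    unfolding eq by (simp add: w gram_kernel_mult gram_kernel_id_frame)
qed

text \<open>
  The identity \<open>M\<^sub>n(s) A = M\<^sub>r(s)\<close>, obtained by integrating \<open>\<bar>det (X\<^sup>T P X)\<bar>\<^sup>s\<close> over the Gaussian matrix
  \<open>X\<close> and the frame \<open>u\<close> in both orders.  It holds in the extended sense, with infinite values allowed.
\<close>
lemma nn_integral_kernel_product:
  fixes v :: "real^'m^'n"
  assumes v: "v \<in> stiefel" and m: "CARD('m) \<le> r"
  shows "(\<Prod>l<CARD('m). gamma_moment ((real CARD('n) - real l) / 2) s) *
      (\<integral>\<^sup>+u. ennreal (gram_kernel (proj u) v powr s) \<partial>\<nu>) =
    (\<Prod>l<CARD('m). gamma_moment ((real r - real l) / 2) s)"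
proof -
  interpret G: prob_space "gaussian_columns :: ('m \<Rightarrow> real^'n) measure"
    by (rule prob_space_gaussian_columns)
  interpret pair_sigma_finite "gaussian_columns :: ('m \<Rightarrow> real^'n) measure" \<nu>
    by standard
  let ?A = "\<integral>\<^sup>+u. ennreal (gram_kernel (proj u) v powr s) \<partial>\<nu>"
  have "(\<integral>\<^sup>+x. (\<integral>\<^sup>+u. ennreal (gram_kernel (proj u) (\<chi> i a. x a $ i :: real^'m^'n) powr s) \<partial>\<nu>) \<partial>gaussian_columns) =
      (\<integral>\<^sup>+x. ennreal (gram_kernel (mat 1) (\<chi> i a. x a $ i :: real^'m^'n) powr s) * ?A \<partial>gaussian_columns)"
    by (intro nn_integral_cong nn_integral_kernel_columns[OF v])
  also have "\<dots> = (\<integral>\<^sup>+x. ennreal (gram_kernel (mat 1) (\<chi> i a. x a $ i :: real^'m^'n) powr s) \<partial>gaussian_columns) * ?A"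
    by (rule nn_integral_multc) measurable
  also have "(\<integral>\<^sup>+x. ennreal (gram_kernel (mat 1) (\<chi> i a. x a $ i :: real^'m^'n) powr s) \<partial>gaussian_columns) =
      (\<Prod>l<CARD('m). gamma_moment ((real CARD('n) - real l) / 2) s)"
    using m r_less
    by (simp add: gram_kernel_columns gaussian_columns_def nn_integral_gram_det orth_projection_id trace_I)
  also have "(\<integral>\<^sup>+x. (\<integral>\<^sup>+u. ennreal (gram_kernel (proj u) (\<chi> i a. x a $ i :: real^'m^'n) powr s) \<partial>\<nu>) \<partial>gaussian_columns) =
      (\<integral>\<^sup>+u. (\<integral>\<^sup>+x. ennreal (gram_kernel (proj u) (\<chi> i a. x a $ i :: real^'m^'n) powr s) \<partial>gaussian_columns) \<partial>\<nu>)"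
    by (rule Fubini'[symmetric]) measurable
  also have "\<dots> = (\<integral>\<^sup>+u. (\<Prod>l<CARD('m). gamma_moment ((real r - real l) / 2) s) \<partial>\<nu>)"
    using m by (intro nn_integral_cong) (simp add: gram_kernel_columns gaussian_columns_def space_nu
        nn_integral_gram_det orth_projection_proj trace_proj)
  also have "\<dots> = (\<Prod>l<CARD('m). gamma_moment ((real r - real l) / 2) s)"
    by (simp add: emeasure_space_1)
  finally show ?thesis ..
qed

lemma kernel_integral_finite:
  fixes v :: "real^'m^'n"
  assumes v: "v \<in> stiefel" and m: "CARD('m) \<le> r" and s: "2 * s + real r > real CARD('m) - 1"
  shows "(\<integral>\<^sup>+u. ennreal (gram_kernel (proj u) v powr s) \<partial>\<nu>) < \<infinity>"
proof (rule ccontr)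
  assume "\<not> (\<integral>\<^sup>+u. ennreal (gram_kernel (proj u) v powr s) \<partial>\<nu>) < \<infinity>"
  then have inf: "(\<integral>\<^sup>+u. ennreal (gram_kernel (proj u) v powr s) \<partial>\<nu>) = \<infinity>"
    by (metis infinity_ennreal_def top.not_eq_extremum)
  have "(\<Prod>l<CARD('m). gamma_moment ((real CARD('n) - real l) / 2) s) \<noteq> 0"
    using m r_less by (auto intro!: gamma_moment_pos)
  moreover have "(\<Prod>l<CARD('m). gamma_moment ((real r - real l) / 2) s) \<noteq> \<infinity>"
  proof -
    have "gamma_moment ((real r - real l) / 2) s \<noteq> \<infinity>" if "l < CARD('m)" for l
    proof -
      have "real l \<le> real CARD('m) - 1"
        using that by (simp add: of_nat_diff[symmetric] Suc_leI flip: of_nat_Suc)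
      then show ?thesis
        using m s that by (subst gamma_moment_eq) (auto simp: field_simps)
    qed
    then show ?thesis
      by (auto simp: ennreal_prod_eq_top)
  qed
  ultimately show False
    using nn_integral_kernel_product[OF v m, of s] by (simp add: inf ennreal_mult_top)
qed

text \<open>
  If \<open>s\<close> is far below the critical exponent \<open>t\<close>, both moments in \<open>nn_integral_kernel_product\<close> are
  infinite and the identity says nothing.  It is therefore used only at \<open>t\<close>, where \<open>r < n\<close> keeps the
  first moment finite, and smaller exponents are compared with \<open>t\<close> by boundedness of the kernel.
\<close>
lemma kernel_integral_infinite:
  fixes v :: "real^'m^'n"
  assumes v: "v \<in> stiefel" and m: "CARD('m) \<le> r" and s: "2 * s + real r \<le> real CARD('m) - 1"
  shows "(\<integral>\<^sup>+u. ennreal (gram_kernel (proj u) v powr s) \<partial>\<nu>) = \<infinity>"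
proof -
  define t where "t = (real CARD('m) - 1 - real r) / 2"
  define B where "B = (fact CARD('m) :: real)"
  have B: "B > 0" by (simp add: B_def)
  have mpos: "CARD('m) > 0" by simp
  have fin: "(\<Prod>l<CARD('m). gamma_moment ((real CARD('n) - real l) / 2) t) \<noteq> \<infinity>"
  proof -
    have "gamma_moment ((real CARD('n) - real l) / 2) t \<noteq> \<infinity>" if "l < CARD('m)" for l
      using m r_less that by (subst gamma_moment_eq) (auto simp: t_def field_simps)
    then show ?thesis
      by (auto simp: ennreal_prod_eq_top)
  qed
  \<comment> \<open>The factor of index \<open>m - 1\<close> is the one whose exponent reaches the boundary.\<close>
  have "gamma_moment ((real r - real (CARD('m) - 1)) / 2) t = \<infinity>"
    using m mpos by (intro gamma_moment_infinite) (auto simp: t_def field_simps of_nat_diff)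
  moreover have "gamma_moment ((real r - real l) / 2) t \<noteq> 0" if "l < CARD('m)" for l
    using m that by (intro gamma_moment_pos) auto
  ultimately have "(\<Prod>l<CARD('m). gamma_moment ((real r - real l) / 2) t) = \<infinity>"
    using mpos by (auto simp: ennreal_prod_eq_top intro!: bexI[of _ "CARD('m) - 1"])
  then have inf: "(\<integral>\<^sup>+u. ennreal (gram_kernel (proj u) v powr t) \<partial>\<nu>) = \<infinity>"
    using nn_integral_kernel_product[OF v m, of t] fin by (auto simp: ennreal_mult_eq_top_iff)
  have "ennreal (B powr (s - t)) * (\<integral>\<^sup>+u. ennreal (gram_kernel (proj u) v powr t) \<partial>\<nu>) =
      (\<integral>\<^sup>+u. ennreal (B powr (s - t)) * ennreal (gram_kernel (proj u) v powr t) \<partial>\<nu>)"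
    by (rule nn_integral_cmult[symmetric]) measurable
  also have "\<dots> \<le> (\<integral>\<^sup>+u. ennreal (gram_kernel (proj u) v powr s) \<partial>\<nu>)"
  proof (rule nn_integral_mono)
    fix u assume u: "u \<in> space \<nu>"
    define q where "q = gram_kernel (proj u) v"
    show "ennreal (B powr (s - t)) * ennreal (gram_kernel (proj u) v powr t) \<le> ennreal (gram_kernel (proj u) v powr s)"
      unfolding q_def[symmetric]
    proof (cases "q = 0")
      case False
      have q: "q > 0" "q \<le> B"
        using False u gram_kernel_le[OF v] unfolding q_def B_def
        by (auto simp: less_le orth_projection_proj space_nu)
      have "B powr (s - t) \<le> q powr (s - t)"
        using q s B by (intro powr_mono2') (auto simp: t_def)
      then have "B powr (s - t) * q powr t \<le> q powr (s - t) * q powr t"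
        by (intro mult_right_mono) auto
      also have "\<dots> = q powr s"
        by (simp flip: powr_add)
      finally show "ennreal (B powr (s - t)) * ennreal (q powr t) \<le> ennreal (q powr s)"
        by (simp add: ennreal_leI flip: ennreal_mult')
    qed simp
  qed
  finally show ?thesis
    using B by (simp add: inf ennreal_mult_top top_unique)
qed

text \<open>
  The identity \<open>M\<^sub>n(z) A = M\<^sub>r(z)\<close> for complex exponents.  The lower bound on \<open>Re z\<close> makes the
  double integral over Gaussian matrices and frames absolutely convergent, since \<open>M\<^sub>r(Re z)\<close> is finite.
\<close>
lemma kernel_integral_complex:
  fixes v :: "real^'m^'n"
  assumes v: "v \<in> stiefel" and m: "CARD('m) \<le> r" and z: "2 * Re z + real r > real CARD('m) - 1"
  shows "(\<Prod>l<CARD('m). Gamma (of_real ((real CARD('n) - real l) / 2) + z) / Gamma (of_real ((real CARD('n) - real l) / 2))) *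
      (\<integral>u. of_real (gram_kernel (proj u) v) powr z \<partial>\<nu>) =
    (\<Prod>l<CARD('m). Gamma (of_real ((real r - real l) / 2) + z) / Gamma (complex_of_real ((real r - real l) / 2)))"
proof -
  interpret G: prob_space "gaussian_columns :: ('m \<Rightarrow> real^'n) measure"
    by (rule prob_space_gaussian_columns)
  interpret pair_sigma_finite "gaussian_columns :: ('m \<Rightarrow> real^'n) measure" \<nu>
    by standard
  let ?q = "\<lambda>x u. gram_kernel (proj u) (\<chi> i a. x a $ i :: real^'m^'n)"
  let ?A = "\<integral>u. complex_of_real (gram_kernel (proj u) v) powr z \<partial>\<nu>"
  have zl: "Re z + (real r - real l) / 2 > 0" if "l < CARD('m)" for l
  proof -
    have "real l \<le> real CARD('m) - 1"
      using that by (simp add: of_nat_diff[symmetric] Suc_leI flip: of_nat_Suc)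
    then show ?thesis
      using z by (simp add: field_simps)
  qed
  have zn: "Re z + (real CARD('n) - real l) / 2 > 0" if "l < CARD('m)" for l
    using zl[OF that] r_less by (simp add: field_simps)
  have "integrable (gaussian_columns \<Otimes>\<^sub>M \<nu>) (\<lambda>(x, u). complex_of_real (?q x u) powr z)"
  proof (rule integrableI_bounded)
    have "(\<integral>\<^sup>+w. ennreal (norm (case w of (x, u) \<Rightarrow> complex_of_real (?q x u) powr z)) \<partial>(gaussian_columns \<Otimes>\<^sub>M \<nu>)) =
        (\<integral>\<^sup>+w. (case w of (x, u) \<Rightarrow> ennreal (?q x u powr Re z)) \<partial>(gaussian_columns \<Otimes>\<^sub>M \<nu>))"
      by (intro nn_integral_cong) (auto simp: norm_of_real_powr)
    also have "\<dots> = (\<integral>\<^sup>+x. (\<integral>\<^sup>+u. ennreal (?q x u powr Re z) \<partial>\<nu>) \<partial>gaussian_columns)"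
      by (subst sigma_finite_measure.nn_integral_fst[OF sigma_finite_nu, symmetric]) simp_all
    also have "\<dots> = (\<integral>\<^sup>+u. (\<integral>\<^sup>+x. ennreal (?q x u powr Re z) \<partial>gaussian_columns) \<partial>\<nu>)"
      by (rule Fubini'[symmetric]) measurable
    also have "\<dots> = (\<integral>\<^sup>+u. (\<Prod>l<CARD('m). gamma_moment ((real r - real l) / 2) (Re z)) \<partial>\<nu>)"
      using m by (intro nn_integral_cong) (simp add: gram_kernel_columns gaussian_columns_def space_nu
          nn_integral_gram_det orth_projection_proj trace_proj)
    also have "\<dots> = (\<Prod>l<CARD('m). gamma_moment ((real r - real l) / 2) (Re z))"
      by (simp add: emeasure_space_1)
    also have "\<dots> < \<infinity>"
    proof -
      have "gamma_moment ((real r - real l) / 2) (Re z) \<noteq> \<infinity>" if "l < CARD('m)" for l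
        using zl[OF that] m that by (subst gamma_moment_eq) (auto simp: add.commute)
      then show ?thesis
        by (auto simp: ennreal_prod_eq_top less_top[symmetric])
    qed
    finally show "(\<integral>\<^sup>+w. ennreal (norm (case w of (x, u) \<Rightarrow> complex_of_real (?q x u) powr z)) \<partial>(gaussian_columns \<Otimes>\<^sub>M \<nu>)) < \<infinity>" .
  qed measurable
  then have "(\<integral>u. (\<integral>x. complex_of_real (?q x u) powr z \<partial>gaussian_columns) \<partial>\<nu>) =
      (\<integral>x. (\<integral>u. complex_of_real (?q x u) powr z \<partial>\<nu>) \<partial>gaussian_columns)"
    by (rule Fubini_integral)
  also have "\<dots> = (\<integral>x. of_real (gram_kernel (mat 1) (\<chi> i a. x a $ i :: real^'m^'n)) powr z * ?A \<partial>gaussian_columns)"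
    by (intro Bochner_Integration.integral_cong refl integral_kernel_columns[OF v])
  also have "\<dots> = (\<integral>x. of_real (gram_kernel (mat 1) (\<chi> i a. x a $ i :: real^'m^'n)) powr z \<partial>gaussian_columns) * ?A"
    by (rule integral_mult_left_zero)
  also have "(\<integral>x. of_real (gram_kernel (mat 1) (\<chi> i a. x a $ i :: real^'m^'n)) powr z \<partial>gaussian_columns) =
      (\<Prod>l<CARD('m). Gamma (of_real ((real CARD('n) - real l) / 2) + z) / Gamma (complex_of_real ((real CARD('n) - real l) / 2)))"
    unfolding gram_kernel_columns gaussian_columns_def using m r_less zn
    by (subst integral_gram_det_powr) (simp_all add: orth_projection_id trace_I)
  also have "(\<integral>u. (\<integral>x. complex_of_real (?q x u) powr z \<partial>gaussian_columns) \<partial>\<nu>) =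
      (\<integral>u. (\<Prod>l<CARD('m). Gamma (of_real ((real r - real l) / 2) + z) / Gamma (complex_of_real ((real r - real l) / 2))) \<partial>\<nu>)"
  proof (rule Bochner_Integration.integral_cong)
    fix u assume "u \<in> space \<nu>"
    then have "u \<in> stiefel" by (simp add: space_nu)
    then show "(\<integral>x. complex_of_real (?q x u) powr z \<partial>gaussian_columns) =
        (\<Prod>l<CARD('m). Gamma (of_real ((real r - real l) / 2) + z) / Gamma (complex_of_real ((real r - real l) / 2)))"
      unfolding gram_kernel_columns gaussian_columns_def using m zl
      by (subst integral_gram_det_powr) (simp_all add: orth_projection_proj trace_proj)
  qed simp
  also have "\<dots> = (\<Prod>l<CARD('m). Gamma (of_real ((real r - real l) / 2) + z) / Gamma (complex_of_real ((real r - real l) / 2)))"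
    by (simp add: prob_space)
  finally show ?thesis ..
qed

text \<open>
  Each of the two integrals is constant in its remaining variable, and both have the same iterated
  integral over \<open>\<mu>\<close> and \<open>\<nu>\<close>.
\<close>
lemma nn_integral_kernel_base:
  fixes v :: "real^'m^'n" and \<mu> :: "(real^'m^'n) measure"
  assumes \<mu>: "invariant_stiefel_measure \<mu>" and v: "v \<in> stiefel" and u: "u \<in> stiefel"
  shows "(\<integral>\<^sup>+v. ennreal (gram_kernel (proj u) v powr s) \<partial>\<mu>) =
    (\<integral>\<^sup>+u. ennreal (gram_kernel (proj u) v powr s) \<partial>\<nu>)"
proof -
  note [measurable] = measurable_stiefel_embed[OF \<mu>]
  interpret M: prob_space \<mu>
    using \<mu> by (rule stiefel_prob_space)
  interpret pair_sigma_finite \<mu> \<nu>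
    by standard
  have base: "(\<integral>\<^sup>+v. ennreal (gram_kernel (proj w) v powr s) \<partial>\<mu>) =
      (\<integral>\<^sup>+r. ennreal (r powr s) \<partial>distr \<mu> borel (\<lambda>v. gram_kernel (proj u) v))" if "w \<in> stiefel" for w
    by (subst distr_kernel_base[OF \<mu> u that], subst nn_integral_distr) simp_all
  have frame: "(\<integral>\<^sup>+u. ennreal (gram_kernel (proj u) w powr s) \<partial>\<nu>) =
      (\<integral>\<^sup>+r. ennreal (r powr s) \<partial>distr \<nu> borel (\<lambda>u. gram_kernel (proj u) v))" if "w \<in> stiefel" for w :: "real^'m^'n"
    by (subst distr_kernel_frame[OF v that], subst nn_integral_distr) simp_all
  have "(\<integral>\<^sup>+v. ennreal (gram_kernel (proj u) v powr s) \<partial>\<mu>) =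
      (\<integral>\<^sup>+w. (\<integral>\<^sup>+r. ennreal (r powr s) \<partial>distr \<mu> borel (\<lambda>v. gram_kernel (proj u) v)) \<partial>\<nu>)"
    unfolding base[OF u] by (simp add: emeasure_space_1)
  also have "\<dots> = (\<integral>\<^sup>+w. (\<integral>\<^sup>+v. ennreal (gram_kernel (proj w) v powr s) \<partial>\<mu>) \<partial>\<nu>)"
    by (intro nn_integral_cong base[symmetric]) (simp add: space_nu)
  also have "\<dots> = (\<integral>\<^sup>+v. (\<integral>\<^sup>+w. ennreal (gram_kernel (proj w) v powr s) \<partial>\<nu>) \<partial>\<mu>)"
    by (rule Fubini') measurable
  also have "\<dots> = (\<integral>\<^sup>+w. (\<integral>\<^sup>+r. ennreal (r powr s) \<partial>distr \<nu> borel (\<lambda>u. gram_kernel (proj u) v)) \<partial>\<mu>)"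
    by (intro nn_integral_cong frame) (simp add: space_stiefel_measure[OF \<mu>])
  also have "\<dots> = (\<integral>\<^sup>+u. ennreal (gram_kernel (proj u) v powr s) \<partial>\<nu>)"
    unfolding frame[OF v] by (simp add: M.emeasure_space_1)
  finally show ?thesis .
qed

lemma integral_kernel_base:
  fixes v :: "real^'m^'n" and \<mu> :: "(real^'m^'n) measure"
  assumes \<mu>: "invariant_stiefel_measure \<mu>" and v: "v \<in> stiefel" and u: "u \<in> stiefel"
    and m: "CARD('m) \<le> r" and z: "2 * Re z + real r > real CARD('m) - 1"
  shows "(\<integral>v. complex_of_real (gram_kernel (proj u) v) powr z \<partial>\<mu>) =
    (\<integral>u. complex_of_real (gram_kernel (proj u) v) powr z \<partial>\<nu>)"
proof -
  note [measurable] = measurable_stiefel_embed[OF \<mu>]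
  interpret M: prob_space \<mu>
    using \<mu> by (rule stiefel_prob_space)
  interpret pair_sigma_finite \<mu> \<nu>
    by standard
  have base: "(\<integral>v. complex_of_real (gram_kernel (proj w) v) powr z \<partial>\<mu>) =
      (\<integral>r. complex_of_real r powr z \<partial>distr \<mu> borel (\<lambda>v. gram_kernel (proj u) v))" if "w \<in> stiefel" for w
    by (subst distr_kernel_base[OF \<mu> u that], subst integral_distr) simp_all
  have frame: "(\<integral>u. complex_of_real (gram_kernel (proj u) w) powr z \<partial>\<nu>) =
      (\<integral>r. complex_of_real r powr z \<partial>distr \<nu> borel (\<lambda>u. gram_kernel (proj u) v))" if "w \<in> stiefel" for w :: "real^'m^'n"
    by (subst distr_kernel_frame[OF v that], subst integral_distr) simp_all
  have int: "integrable (\<mu> \<Otimes>\<^sub>M \<nu>) (\<lambda>(v, u). complex_of_real (gram_kernel (proj u) v) powr z)"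
  proof (rule integrableI_bounded)
    have "(\<integral>\<^sup>+w. ennreal (norm (case w of (v, u) \<Rightarrow> complex_of_real (gram_kernel (proj u) v) powr z)) \<partial>(\<mu> \<Otimes>\<^sub>M \<nu>)) =
        (\<integral>\<^sup>+w. (case w of (v, u) \<Rightarrow> ennreal (gram_kernel (proj u) v powr Re z)) \<partial>(\<mu> \<Otimes>\<^sub>M \<nu>))"
      by (intro nn_integral_cong) (auto simp: norm_of_real_powr)
    also have "\<dots> = (\<integral>\<^sup>+v. (\<integral>\<^sup>+u. ennreal (gram_kernel (proj u) v powr Re z) \<partial>\<nu>) \<partial>\<mu>)"
      by (subst sigma_finite_measure.nn_integral_fst[OF sigma_finite_nu, symmetric]) simp_all
    also have "\<dots> = (\<integral>\<^sup>+(w :: real^'m^'n). (\<integral>\<^sup>+v. ennreal (gram_kernel (proj u) v powr Re z) \<partial>\<mu>) \<partial>\<mu>)"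
      by (intro nn_integral_cong nn_integral_kernel_base[OF \<mu> _ u, symmetric])
        (simp add: space_stiefel_measure[OF \<mu>])
    also have "\<dots> = (\<integral>\<^sup>+u. ennreal (gram_kernel (proj u) v powr Re z) \<partial>\<nu>)"
      by (simp add: M.emeasure_space_1 nn_integral_kernel_base[OF \<mu> v u])
    also have "\<dots> < \<infinity>"
      by (rule kernel_integral_finite[OF v m z])
    finally show "(\<integral>\<^sup>+w. ennreal (norm (case w of (v, u) \<Rightarrow> complex_of_real (gram_kernel (proj u) v) powr z)) \<partial>(\<mu> \<Otimes>\<^sub>M \<nu>)) < \<infinity>" .
  qed measurable
  have "(\<integral>v. complex_of_real (gram_kernel (proj u) v) powr z \<partial>\<mu>) =
      (\<integral>w. (\<integral>r. complex_of_real r powr z \<partial>distr \<mu> borel (\<lambda>v. gram_kernel (proj u) v)) \<partial>\<nu>)"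
    unfolding base[OF u] by (simp add: prob_space)
  also have "\<dots> = (\<integral>w. (\<integral>v. complex_of_real (gram_kernel (proj w) v) powr z \<partial>\<mu>) \<partial>\<nu>)"
    by (intro Bochner_Integration.integral_cong base[symmetric] refl) (simp add: space_nu)
  also have "\<dots> = (\<integral>v. (\<integral>w. complex_of_real (gram_kernel (proj w) v) powr z \<partial>\<nu>) \<partial>\<mu>)"
    using int by (rule Fubini_integral)
  also have "\<dots> = (\<integral>w. (\<integral>r. complex_of_real r powr z \<partial>distr \<nu> borel (\<lambda>u. gram_kernel (proj u) v)) \<partial>\<mu>)"
    by (intro Bochner_Integration.integral_cong frame refl) (simp add: space_stiefel_measure[OF \<mu>])
  also have "\<dots> = (\<integral>u. complex_of_real (gram_kernel (proj u) v) powr z \<partial>\<nu>)"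
    unfolding frame[OF v] by (simp add: M.prob_space)
  finally show ?thesis .
qed

end

text \<open>
  The bound makes \<open>f v K v u\<close> absolutely integrable on the product space, and Fubini's theorem yields
  all three claims.
\<close>
lemma integral_operator:
  fixes K :: "'a \<Rightarrow> 'b \<Rightarrow> complex"
  assumes "prob_space M" "prob_space N"
    and [measurable]: "case_prod K \<in> borel_measurable (M \<Otimes>\<^sub>M N)"
    and bound: "\<And>v. v \<in> space M \<Longrightarrow> (\<integral>\<^sup>+u. ennreal (norm (K v u)) \<partial>N) \<le> B" "B < \<infinity>"
    and val: "\<And>v. v \<in> space M \<Longrightarrow> (\<integral>u. K v u \<partial>N) = c"
    and f: "integrable M f"
  shows "AE u in N. integrable M (\<lambda>v. f v * K v u)"
    and "integrable N (\<lambda>u. \<integral>v. f v * K v u \<partial>M)"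
    and "(\<integral>u. (\<integral>v. f v * K v u \<partial>M) \<partial>N) = c * (\<integral>v. f v \<partial>M)"
proof -
  interpret M: prob_space M by fact
  interpret N: prob_space N by fact
  interpret pair_sigma_finite M N by standard
  have [measurable]: "f \<in> borel_measurable M"
    using f by simp
  have int: "integrable (M \<Otimes>\<^sub>M N) (\<lambda>(v, u). f v * K v u)"
  proof (rule integrableI_bounded)
    have "(\<integral>\<^sup>+w. ennreal (norm (case w of (v, u) \<Rightarrow> f v * K v u)) \<partial>(M \<Otimes>\<^sub>M N)) =
        (\<integral>\<^sup>+v. (\<integral>\<^sup>+u. ennreal (norm (f v * K v u)) \<partial>N) \<partial>M)"
      by (subst N.nn_integral_fst[symmetric]) simp_all
    also have "\<dots> = (\<integral>\<^sup>+v. ennreal (norm (f v)) * (\<integral>\<^sup>+u. ennreal (norm (K v u)) \<partial>N) \<partial>M)"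
      by (intro nn_integral_cong) (simp add: norm_mult ennreal_mult nn_integral_cmult)
    also have "\<dots> \<le> (\<integral>\<^sup>+v. ennreal (norm (f v)) * B \<partial>M)"
      using bound(1) by (intro nn_integral_mono mult_left_mono) auto
    also have "\<dots> = (\<integral>\<^sup>+v. ennreal (norm (f v)) \<partial>M) * B"
      by (rule nn_integral_multc) measurable
    also have "\<dots> < \<infinity>"
      using f bound(2) by (simp add: integrable_iff_bounded ennreal_mult_less_top)
    finally show "(\<integral>\<^sup>+w. ennreal (norm (case w of (v, u) \<Rightarrow> f v * K v u)) \<partial>(M \<Otimes>\<^sub>M N)) < \<infinity>" .
  qed measurable
  show "AE u in N. integrable M (\<lambda>v. f v * K v u)"
    by (rule AE_integrable_snd[OF int])
  show "integrable N (\<lambda>u. \<integral>v. f v * K v u \<partial>M)"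
    by (rule integrable_snd[OF int])
  have "(\<integral>u. (\<integral>v. f v * K v u \<partial>M) \<partial>N) = (\<integral>v. (\<integral>u. f v * K v u \<partial>N) \<partial>M)"
    by (rule Fubini_integral[OF int])
  also have "\<dots> = (\<integral>v. f v * c \<partial>M)"
    by (intro Bochner_Integration.integral_cong refl) (simp add: val)
  finally show "(\<integral>u. (\<integral>v. f v * K v u \<partial>M) \<partial>N) = c * (\<integral>v. f v \<partial>M)"
    by (simp add: mult.commute)
qed

section \<open>Mapping properties of the transforms\<close>

lemma Gamma_nonzero_half_plane: "Re z > 0 \<Longrightarrow> Gamma z \<noteq> (0 :: complex)"
  by (auto simp: Gamma_eq_zero_iff elim!: nonpos_Ints_cases)

lemma AE_imp_exists:
  assumes "prob_space N" "AE u in N. P u"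
  shows "\<exists>u\<in>space N. P u"
proof (rule ccontr)
  assume "\<not> (\<exists>u\<in>space N. P u)"
  then have "AE u in N. P u \<longrightarrow> False"
    by (intro AE_I2) auto
  with assms(2) have "AE u in N. False"
    by (rule AE_mp)
  then show False
    using assms(1) by (simp add: prob_space.AE_False)
qed

context projection_family
begin

text \<open>
  With \<open>s = (\<alpha> - r) / 2\<close> the Gamma functions in the numerators of \<open>M\<^sub>r(s)\<close> and \<open>M\<^sub>n(s)\<close> have the
  arguments \<open>(r - l) / 2 + s = (\<alpha> - l) / 2\<close> and \<open>(n - l) / 2 + s = (\<alpha> + n - r - l) / 2\<close>, which are
  those in the Siegel Gamma functions.
  The powers of \<open>\<pi>\<close> cancel.
\<close>
lemma kernel_value:
  fixes v :: "real^'m^'n"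
  assumes v: "v \<in> stiefel" and m: "CARD('m) \<le> r" and \<alpha>: "Re \<alpha> > real CARD('m) - 1"
  shows "(\<integral>u. of_real (gram_kernel (proj u) v) powr ((\<alpha> - of_nat r) / 2) \<partial>\<nu>) =
    siegel_Gamma CARD('m) (of_nat CARD('n) / 2) * siegel_Gamma CARD('m) (\<alpha> / 2) /
    (siegel_Gamma CARD('m) (of_nat r / 2) * siegel_Gamma CARD('m) ((\<alpha> + of_nat CARD('n) - of_nat r) / 2))"
    (is "?I = _")
proof -
  let ?m = "CARD('m)" and ?n = "CARD('n)"
  define a b d e where
    "a l = Gamma (of_nat ?n / 2 - of_nat l / 2 :: complex)" and
    "b l = Gamma (\<alpha> / 2 - of_nat l / 2)" and
    "d l = Gamma (of_nat r / 2 - of_nat l / 2 :: complex)" and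
    "e l = Gamma ((\<alpha> + of_nat ?n - of_nat r) / 2 - of_nat l / 2)" for l
  define p where "p = complex_of_real (pi powr (real ?m * (real ?m - 1) / 4))"
  have p: "p \<noteq> 0" by (simp add: p_def)
  have le: "real l \<le> real ?m - 1" if "l < ?m" for l
    using that by (simp add: of_nat_diff[symmetric] Suc_leI flip: of_nat_Suc)
  have nz: "a l \<noteq> 0" "d l \<noteq> 0" "e l \<noteq> 0" if "l < ?m" for l
    unfolding a_def d_def e_def using le[OF that] that m r_less \<alpha>
    by (auto intro!: Gamma_nonzero_half_plane)
  have nz': "prod a {..<?m} \<noteq> 0" "prod d {..<?m} \<noteq> 0" "prod e {..<?m} \<noteq> 0"
    using nz by auto
  have z: "2 * Re ((\<alpha> - of_nat r) / 2) + real r > real ?m - 1"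
    using \<alpha> by (simp add: field_simps)
  have "(\<Prod>l<?m. e l / a l) * ?I = (\<Prod>l<?m. b l / d l)"
  proof -
    have "e l / a l = Gamma (of_real ((real ?n - real l) / 2) + (\<alpha> - of_nat r) / 2) / Gamma (of_real ((real ?n - real l) / 2))" for l
      unfolding e_def a_def by (intro arg_cong2[where f="(/)"] arg_cong[where f=Gamma]) (simp_all add: field_simps)
    moreover have "b l / d l = Gamma (of_real ((real r - real l) / 2) + (\<alpha> - of_nat r) / 2) / Gamma (of_real ((real r - real l) / 2))" for l
      unfolding b_def d_def by (intro arg_cong2[where f="(/)"] arg_cong[where f=Gamma]) (simp_all add: field_simps)
    ultimately show ?thesis
      using kernel_integral_complex[OF v m z] by simp
  qed
  then have "?I = (prod b {..<?m} / prod d {..<?m}) / (prod e {..<?m} / prod a {..<?m})"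
    using nz' by (simp add: prod_dividef field_simps)
  also have "\<dots> = (p * prod a {..<?m}) * (p * prod b {..<?m}) / ((p * prod d {..<?m}) * (p * prod e {..<?m}))"
    using nz' p by (simp add: field_simps)
  finally show ?thesis
    by (simp add: siegel_Gamma_def a_def b_def d_def e_def p_def)
qed

context
  fixes \<mu> :: "(real^'m^'n) measure" and \<alpha> :: complex and K :: "real^'m^'n \<Rightarrow> real^'k^'n \<Rightarrow> complex"
  assumes \<mu>: "invariant_stiefel_measure \<mu>" and m: "CARD('m) \<le> r"
    and K: "\<And>v u. v \<in> stiefel \<Longrightarrow> K v u = of_real (gram_kernel (proj u) v) powr ((\<alpha> - of_nat r) / 2)"
begin

interpretation M: prob_space \<mu>
  using \<mu> by (rule stiefel_prob_space)

lemma space_mu: "space \<mu> = stiefel"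
  using \<mu> by (rule space_stiefel_measure)

lemma measurable_kernel:
  "case_prod K \<in> borel_measurable (\<mu> \<Otimes>\<^sub>M \<nu>)" "(\<lambda>(u, v). K v u) \<in> borel_measurable (\<nu> \<Otimes>\<^sub>M \<mu>)"
proof -
  note [measurable] = measurable_stiefel_embed[OF \<mu>]
  have "case_prod K \<in> borel_measurable (\<mu> \<Otimes>\<^sub>M \<nu>) \<longleftrightarrow>
      (\<lambda>(v, u). complex_of_real (gram_kernel (proj u) v) powr ((\<alpha> - of_nat r) / 2)) \<in> borel_measurable (\<mu> \<Otimes>\<^sub>M \<nu>)"
    by (intro measurable_cong) (auto simp: space_pair_measure space_mu K)
  then show "case_prod K \<in> borel_measurable (\<mu> \<Otimes>\<^sub>M \<nu>)"
    by simp
  have "(\<lambda>(u, v). K v u) \<in> borel_measurable (\<nu> \<Otimes>\<^sub>M \<mu>) \<longleftrightarrow>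
      (\<lambda>(u, v). complex_of_real (gram_kernel (proj u) v) powr ((\<alpha> - of_nat r) / 2)) \<in> borel_measurable (\<nu> \<Otimes>\<^sub>M \<mu>)"
    by (intro measurable_cong) (auto simp: space_pair_measure space_mu K)
  then show "(\<lambda>(u, v). K v u) \<in> borel_measurable (\<nu> \<Otimes>\<^sub>M \<mu>)"
    by simp
qed

lemma nn_integral_norm_kernel:
  assumes "v \<in> stiefel"
  shows "(\<integral>\<^sup>+u. ennreal (norm (K v u)) \<partial>\<nu>) =
      (\<integral>\<^sup>+u. ennreal (gram_kernel (proj u) v powr ((Re \<alpha> - real r) / 2)) \<partial>\<nu>)"
  using assms by (simp add: K norm_of_real_powr)

lemma nn_integral_norm_kernel_base:
  assumes v: "v \<in> (stiefel :: (real^'m^'n) set)" and u: "u \<in> stiefel"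
  shows "(\<integral>\<^sup>+v. ennreal (norm (K v u)) \<partial>\<mu>) =
      (\<integral>\<^sup>+u. ennreal (gram_kernel (proj u) v powr ((Re \<alpha> - real r) / 2)) \<partial>\<nu>)"
proof -
  have "(\<integral>\<^sup>+v. ennreal (norm (K v u)) \<partial>\<mu>) =
      (\<integral>\<^sup>+v. ennreal (gram_kernel (proj u) v powr ((Re \<alpha> - real r) / 2)) \<partial>\<mu>)"
    by (intro nn_integral_cong) (simp add: space_mu K norm_of_real_powr)
  also have "\<dots> = (\<integral>\<^sup>+u. ennreal (gram_kernel (proj u) v powr ((Re \<alpha> - real r) / 2)) \<partial>\<nu>)"
    by (rule nn_integral_kernel_base[OF \<mu> v u])
  finally show ?thesis .
qed

lemma frame_exists: obtains v where "v \<in> (stiefel :: (real^'m^'n) set)"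
  using M.not_empty by (auto simp: space_mu)

context
  assumes \<alpha>: "Re \<alpha> > real CARD('m) - 1"
begin

lemma kernel_finite:
  fixes v :: "real^'m^'n"
  assumes "v \<in> stiefel"
  shows "(\<integral>\<^sup>+u. ennreal (gram_kernel (proj u) v powr ((Re \<alpha> - real r) / 2)) \<partial>\<nu>) < \<infinity>"
  using \<alpha> by (intro kernel_integral_finite[OF assms m]) (simp add: field_simps)

lemma kernel_transform:
  fixes c :: complex
  assumes c: "c = siegel_Gamma CARD('m) (of_nat CARD('n) / 2) * siegel_Gamma CARD('m) (\<alpha> / 2) /
    (siegel_Gamma CARD('m) (of_nat r / 2) * siegel_Gamma CARD('m) ((\<alpha> + of_nat CARD('n) - of_nat r) / 2))"
    and f: "integrable \<mu> f"
  shows "AE u in \<nu>. integrable \<mu> (\<lambda>v. f v * K v u)"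
    and "integrable \<nu> (\<lambda>u. \<integral>v. f v * K v u \<partial>\<mu>)"
    and "(\<integral>u. (\<integral>v. f v * K v u \<partial>\<mu>) \<partial>\<nu>) = c * (\<integral>v. f v \<partial>\<mu>)"
proof -
  obtain v0 where v0: "v0 \<in> (stiefel :: (real^'m^'n) set)"
    by (rule frame_exists)
  obtain u0 where u0: "u0 \<in> (stiefel :: (real^'k^'n) set)"
    using not_empty by (auto simp: space_nu)
  have bound: "(\<integral>\<^sup>+u. ennreal (norm (K v u)) \<partial>\<nu>) \<le>
      (\<integral>\<^sup>+u. ennreal (gram_kernel (proj u) v0 powr ((Re \<alpha> - real r) / 2)) \<partial>\<nu>)" if "v \<in> space \<mu>" for v
    using that nn_integral_norm_kernel[of v] nn_integral_norm_kernel_base[OF _ u0, of v]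
      nn_integral_norm_kernel_base[OF v0 u0] by (simp add: space_mu)
  have val: "(\<integral>u. K v u \<partial>\<nu>) = c" if "v \<in> space \<mu>" for v
    using that kernel_value[OF _ m \<alpha>, of v] by (simp add: space_mu K c)
  note op = integral_operator[OF M.prob_space_axioms prob_space_axioms measurable_kernel(1) bound
      kernel_finite[OF v0] val f]
  show "AE u in \<nu>. integrable \<mu> (\<lambda>v. f v * K v u)"
    "integrable \<nu> (\<lambda>u. \<integral>v. f v * K v u \<partial>\<mu>)"
    "(\<integral>u. (\<integral>v. f v * K v u \<partial>\<mu>) \<partial>\<nu>) = c * (\<integral>v. f v \<partial>\<mu>)"
    by (rule op; assumption)+
qed

lemma kernel_dual_transform:
  fixes c :: complex
  assumes c: "c = siegel_Gamma CARD('m) (of_nat CARD('n) / 2) * siegel_Gamma CARD('m) (\<alpha> / 2) /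
    (siegel_Gamma CARD('m) (of_nat r / 2) * siegel_Gamma CARD('m) ((\<alpha> + of_nat CARD('n) - of_nat r) / 2))"
    and \<phi>: "integrable \<nu> \<phi>"
  shows "AE v in \<mu>. integrable \<nu> (\<lambda>u. \<phi> u * K v u)"
    and "integrable \<mu> (\<lambda>v. \<integral>u. \<phi> u * K v u \<partial>\<nu>)"
    and "(\<integral>v. (\<integral>u. \<phi> u * K v u \<partial>\<nu>) \<partial>\<mu>) = c * (\<integral>u. \<phi> u \<partial>\<nu>)"
proof -
  obtain v0 where v0: "v0 \<in> (stiefel :: (real^'m^'n) set)"
    by (rule frame_exists)
  have bound: "(\<integral>\<^sup>+v. ennreal (norm (K v u)) \<partial>\<mu>) \<le>
      (\<integral>\<^sup>+u. ennreal (gram_kernel (proj u) v0 powr ((Re \<alpha> - real r) / 2)) \<partial>\<nu>)" if "u \<in> space \<nu>" for u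
    using that nn_integral_norm_kernel_base[OF v0, of u] by (simp add: space_nu)
  have val: "(\<integral>v. K v u \<partial>\<mu>) = c" if "u \<in> space \<nu>" for u
  proof -
    have z: "2 * Re ((\<alpha> - of_nat r) / 2) + real r > real CARD('m) - 1"
      using \<alpha> by (simp add: field_simps)
    have "(\<integral>v. K v u \<partial>\<mu>) = (\<integral>v. of_real (gram_kernel (proj u) v) powr ((\<alpha> - of_nat r) / 2) \<partial>\<mu>)"
      by (intro Bochner_Integration.integral_cong refl) (simp add: space_mu K)
    also have "\<dots> = (\<integral>u. of_real (gram_kernel (proj u) v0) powr ((\<alpha> - of_nat r) / 2) \<partial>\<nu>)"
      using that by (intro integral_kernel_base[OF \<mu> v0 _ m z]) (simp add: space_nu)
    finally show ?thesis
      by (simp add: c kernel_value[OF v0 m \<alpha>])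
  qed
  note op = integral_operator[where K="\<lambda>u v. K v u", OF prob_space_axioms M.prob_space_axioms
      measurable_kernel(2) bound kernel_finite[OF v0] val \<phi>]
  show "AE v in \<mu>. integrable \<nu> (\<lambda>u. \<phi> u * K v u)"
    "integrable \<mu> (\<lambda>v. \<integral>u. \<phi> u * K v u \<partial>\<nu>)"
    "(\<integral>v. (\<integral>u. \<phi> u * K v u \<partial>\<nu>) \<partial>\<mu>) = c * (\<integral>u. \<phi> u \<partial>\<nu>)"
    by (rule op; assumption)+
qed

end

text \<open>
  Necessity is tested on \<open>f = 1\<close>: almost everywhere convergence gives a single point \<open>u\<close> at which the
  kernel is integrable, but its integral is infinite at every point.
\<close>
lemma kernel_transform_converges_iff:
  "(\<forall>f :: real^'m^'n \<Rightarrow> complex. integrable \<mu> f \<longrightarrow> (AE u in \<nu>. integrable \<mu> (\<lambda>v. f v * K v u)))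
    \<longleftrightarrow> Re \<alpha> > real CARD('m) - 1" (is "?L \<longleftrightarrow> ?R")
proof
  assume ?L
  then have "AE u in \<nu>. integrable \<mu> (\<lambda>v. 1 * K v u)"
    by (rule allE[where x="\<lambda>_. 1"]) simp
  then have "\<exists>u\<in>space \<nu>. integrable \<mu> (\<lambda>v. K v u)"
    using AE_imp_exists[OF prob_space_axioms] by fastforce
  then obtain u where u: "u \<in> stiefel" "integrable \<mu> (\<lambda>v. K v u)"
    by (auto simp: space_nu)
  obtain v0 where v0: "v0 \<in> (stiefel :: (real^'m^'n) set)"
    by (rule frame_exists)
  have "(\<integral>\<^sup>+u. ennreal (gram_kernel (proj u) v0 powr ((Re \<alpha> - real r) / 2)) \<partial>\<nu>) < \<infinity>"
    using u by (simp add: integrable_iff_bounded nn_integral_norm_kernel_base[OF v0])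
  then show ?R
    using kernel_integral_infinite[OF v0 m, of "(Re \<alpha> - real r) / 2"]
    by (cases ?R) (auto simp: field_simps)
next
  assume ?R
  then show ?L
    using kernel_transform(1)[OF _ refl] by blast
qed

lemma kernel_dual_transform_converges_iff:
  "(\<forall>\<phi> :: real^'k^'n \<Rightarrow> complex. integrable \<nu> \<phi> \<longrightarrow> (AE v in \<mu>. integrable \<nu> (\<lambda>u. \<phi> u * K v u)))
    \<longleftrightarrow> Re \<alpha> > real CARD('m) - 1" (is "?L \<longleftrightarrow> ?R")
proof
  assume ?L
  then have "AE v in \<mu>. integrable \<nu> (\<lambda>u. 1 * K v u)"
    by (rule allE[where x="\<lambda>_. 1"]) simp
  then have "\<exists>v\<in>space \<mu>. integrable \<nu> (\<lambda>u. K v u)"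
    using AE_imp_exists[OF M.prob_space_axioms] by fastforce
  then obtain v where v: "v \<in> stiefel" "integrable \<nu> (\<lambda>u. K v u)"
    by (auto simp: space_mu)
  then have "(\<integral>\<^sup>+u. ennreal (gram_kernel (proj u) v powr ((Re \<alpha> - real r) / 2)) \<partial>\<nu>) < \<infinity>"
    by (simp add: integrable_iff_bounded nn_integral_norm_kernel)
  then show ?R
    using kernel_integral_infinite[OF v(1) m, of "(Re \<alpha> - real r) / 2"]
    by (cases ?R) (auto simp: field_simps)
next
  assume ?R
  then show ?L
    using kernel_dual_transform(1)[OF _ refl] by blast
qed

end

end


lemma frame_measurable:
  "(\<lambda>u. u ** transpose u) \<in> borel_measurable (borel :: (real^'k^'n) measure)"
  by measurable

lemma projection_family_frame:
  fixes \<nu> :: "(real^'k^'n) measure"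
  assumes \<nu>: "invariant_stiefel_measure \<nu>" and k: "CARD('k) < CARD('n)"
  shows "projection_family \<nu> (\<lambda>u. u ** transpose u) CARD('k)"
proof
  show "(\<lambda>u. u ** transpose u) \<in> borel_measurable (borel :: (real^'k^'n) measure)"
    by (rule frame_measurable)
  fix u :: "real^'k^'n" assume u: "u \<in> stiefel"
  show "orth_projection (u ** transpose u)"
    using u by (intro orth_projection_frame) (simp add: stiefel_def)
  show "trace (u ** transpose u) = real CARD('k)"
    using u by (subst trace_mul_sym) (simp add: stiefel_def trace_I)
  fix F :: "real^'n^'n"
  show "(F ** u) ** transpose (F ** u) = F ** (u ** transpose u) ** transpose F"
    by (simp add: matrix_transpose_mul matrix_mul_assoc)
qed (use \<nu> k in auto)

lemma matrix_diff_ldistrib: "A ** (B - C) = A ** B - A ** C" for A :: "real^'b^'a"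
  by (simp add: vec_eq_iff matrix_matrix_mult_def right_diff_distrib sum_subtractf)

lemma matrix_diff_rdistrib: "(B - C) ** A = B ** A - C ** A" for A :: "real^'b^'a"
  by (simp add: vec_eq_iff matrix_matrix_mult_def left_diff_distrib sum_subtractf)

lemma projection_family_complement:
  fixes \<nu> :: "(real^'k^'n) measure"
  assumes \<nu>: "invariant_stiefel_measure \<nu>" and k: "CARD('k) < CARD('n)"
  shows "projection_family \<nu> (\<lambda>u. mat 1 - u ** transpose u) (CARD('n) - CARD('k))"
proof
  note [measurable] = frame_measurable
  show "(\<lambda>u. mat 1 - u ** transpose u) \<in> borel_measurable (borel :: (real^'k^'n) measure)"
    by measurable
  fix u :: "real^'k^'n" assume u: "u \<in> stiefel"
  interpret projection_family \<nu> "\<lambda>u. u ** transpose u" "CARD('k)"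
    using assms by (rule projection_family_frame)
  have "orth_projection (u ** transpose u)"
    using u by (rule orth_projection_proj)
  moreover have "transpose (mat 1 - A) = mat 1 - transpose A" for A :: "real^'n^'n"
    by (simp add: vec_eq_iff transpose_def mat_def)
  ultimately show "orth_projection (mat 1 - u ** transpose u)"
    by (simp add: orth_projection_def matrix_diff_ldistrib matrix_diff_rdistrib)
  show "trace (mat 1 - u ** transpose u) = real (CARD('n) - CARD('k))"
    using trace_proj[OF u] k by (simp add: trace_sub trace_I of_nat_diff)
  fix F :: "real^'n^'n" assume "orthogonal_matrix F"
  then show "mat 1 - (F ** u) ** transpose (F ** u) = F ** (mat 1 - u ** transpose u) ** transpose F"
    using proj_rotate[OF _ u, of F]
    by (simp add: matrix_diff_ldistrib matrix_diff_rdistrib orthogonal_matrix_def)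
qed (use \<nu> k in auto)

lemma cosine_kernel_eq:
  "cosine_kernel \<alpha> v u = of_real (gram_kernel (u ** transpose u) v) powr ((\<alpha> - of_nat CARD('k)) / 2)"
  for u :: "real^'k^'n"
  by (simp add: cosine_kernel_def gram_kernel_def matrix_mul_assoc)

text \<open>
  For a frame \<open>v\<close> one has \<open>I = v\<^sup>T v\<close>, so \<open>I - v\<^sup>T u u\<^sup>T v = v\<^sup>T (I - u u\<^sup>T) v\<close>.
\<close>
lemma sine_kernel_eq:
  fixes u :: "real^'k^'n"
  assumes "v \<in> stiefel" "CARD('k) \<le> CARD('n)"
  shows "sine_kernel \<alpha> v u =
    of_real (gram_kernel (mat 1 - u ** transpose u) v) powr ((\<alpha> - of_nat (CARD('n) - CARD('k))) / 2)"
proof -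
  have "transpose v ** (mat 1 - u ** transpose u) ** v = mat 1 - transpose v ** u ** transpose u ** v"
    using assms(1) by (simp add: matrix_diff_ldistrib matrix_diff_rdistrib matrix_mul_assoc stiefel_def)
  moreover have "\<alpha> + of_nat CARD('k) - of_nat CARD('n) = \<alpha> - of_nat (CARD('n) - CARD('k))"
    using assms(2) by (simp add: of_nat_diff)
  ultimately show ?thesis
    by (simp only: sine_kernel_def gram_kernel_def)
qed

theorem theorem4p2:
  fixes \<mu> :: "(real^'m^'n) measure" and \<nu> :: "(real^'k^'n) measure" and \<alpha> :: complex
    and n m k :: nat and c\<^sub>1 c\<^sub>2 :: complex
  assumes "n = CARD('n)" and "m = CARD('m)" and "k = CARD('k)"
  assumes "c\<^sub>1 =
      siegel_Gamma m (of_nat n / 2) * siegel_Gamma m (\<alpha> / 2) /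
      (siegel_Gamma m (of_nat k / 2) * siegel_Gamma m ((\<alpha> + of_nat n - of_nat k) / 2))"
    and "c\<^sub>2 =
      siegel_Gamma m (of_nat n / 2) * siegel_Gamma m (\<alpha> / 2) /
      (siegel_Gamma m (of_nat (n - k) / 2) * siegel_Gamma m ((\<alpha> + of_nat k) / 2))"
  assumes "1 \<le> m" "m \<le> n - 1" and "1 \<le> k" "k \<le> n - 1"
    and "invariant_stiefel_measure \<mu>" and "invariant_stiefel_measure \<nu>"
  shows
    "(m \<le> k \<longrightarrow>
        ((\<forall>f :: real^'m^'n \<Rightarrow> complex. integrable \<mu> f \<longrightarrow>
            (AE u in \<nu>. integrable \<mu> (\<lambda>v. f v * cosine_kernel \<alpha> v u)))
          \<longleftrightarrow> Re \<alpha> > real m - 1) \<and>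
        ((\<forall>\<phi> :: real^'k^'n \<Rightarrow> complex. integrable \<nu> \<phi> \<longrightarrow>
            (AE v in \<mu>. integrable \<nu> (\<lambda>u. \<phi> u * cosine_kernel \<alpha> v u)))
          \<longleftrightarrow> Re \<alpha> > real m - 1)) \<and>
     (m \<le> n - k \<longrightarrow>
        ((\<forall>f :: real^'m^'n \<Rightarrow> complex. integrable \<mu> f \<longrightarrow>
            (AE u in \<nu>. integrable \<mu> (\<lambda>v. f v * sine_kernel \<alpha> v u)))
          \<longleftrightarrow> Re \<alpha> > real m - 1) \<and>
        ((\<forall>\<phi> :: real^'k^'n \<Rightarrow> complex. integrable \<nu> \<phi> \<longrightarrow>
            (AE v in \<mu>. integrable \<nu> (\<lambda>u. \<phi> u * sine_kernel \<alpha> v u)))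
          \<longleftrightarrow> Re \<alpha> > real m - 1)) \<and>
     (m \<le> k \<and> Re \<alpha> > real m - 1 \<longrightarrow>
        (\<forall>f :: real^'m^'n \<Rightarrow> complex. integrable \<mu> f \<longrightarrow>
            integrable \<nu> (cosine_transform \<mu> \<alpha> f) \<and>
            (\<integral>u. cosine_transform \<mu> \<alpha> f u \<partial>\<nu>) = c\<^sub>1 * (\<integral>v. f v \<partial>\<mu>)) \<and>
        (\<forall>\<phi> :: real^'k^'n \<Rightarrow> complex. integrable \<nu> \<phi> \<longrightarrow>
            integrable \<mu> (dual_cosine_transform \<nu> \<alpha> \<phi>) \<and>
            (\<integral>v. dual_cosine_transform \<nu> \<alpha> \<phi> v \<partial>\<mu>) = c\<^sub>1 * (\<integral>u. \<phi> u \<partial>\<nu>))) \<and>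
     (m \<le> n - k \<and> Re \<alpha> > real m - 1 \<longrightarrow>
        (\<forall>f :: real^'m^'n \<Rightarrow> complex. integrable \<mu> f \<longrightarrow>
            integrable \<nu> (sine_transform \<mu> \<alpha> f) \<and>
            (\<integral>u. sine_transform \<mu> \<alpha> f u \<partial>\<nu>) = c\<^sub>2 * (\<integral>v. f v \<partial>\<mu>)) \<and>
        (\<forall>\<phi> :: real^'k^'n \<Rightarrow> complex. integrable \<nu> \<phi> \<longrightarrow>
            integrable \<mu> (dual_sine_transform \<nu> \<alpha> \<phi>) \<and>
            (\<integral>v. dual_sine_transform \<nu> \<alpha> \<phi> v \<partial>\<mu>) = c\<^sub>2 * (\<integral>u. \<phi> u \<partial>\<nu>)))"
proof -
  have kn: "CARD('k) < CARD('n)"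
    using assms(1,3) \<open>k \<le> n - 1\<close> zero_less_card_finite[where 'a='n] by linarith
  interpret cosine: projection_family \<nu> "\<lambda>u. u ** transpose u" "CARD('k)"
    using \<open>invariant_stiefel_measure \<nu>\<close> kn by (rule projection_family_frame)
  interpret sine: projection_family \<nu> "\<lambda>u. mat 1 - u ** transpose u" "CARD('n) - CARD('k)"
    using \<open>invariant_stiefel_measure \<nu>\<close> kn by (rule projection_family_complement)
  have sine_eq: "sine_kernel \<alpha> v u = of_real (gram_kernel (mat 1 - u ** transpose u) v) powr
      ((\<alpha> - of_nat (CARD('n) - CARD('k))) / 2)" if "v \<in> stiefel" for v :: "real^'m^'n" and u :: "real^'k^'n"
    by (rule sine_kernel_eq[OF that less_imp_le[OF kn]])
  have c1: "c\<^sub>1 = siegel_Gamma CARD('m) (of_nat CARD('n) / 2) * siegel_Gamma CARD('m) (\<alpha> / 2) /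
      (siegel_Gamma CARD('m) (of_nat CARD('k) / 2) *
       siegel_Gamma CARD('m) ((\<alpha> + of_nat CARD('n) - of_nat CARD('k)) / 2))"
    using assms(1-4) by simp
  have c2: "c\<^sub>2 = siegel_Gamma CARD('m) (of_nat CARD('n) / 2) * siegel_Gamma CARD('m) (\<alpha> / 2) /
      (siegel_Gamma CARD('m) (of_nat (CARD('n) - CARD('k)) / 2) *
       siegel_Gamma CARD('m) ((\<alpha> + of_nat CARD('n) - of_nat (CARD('n) - CARD('k))) / 2))"
  proof -
    have "\<alpha> + of_nat CARD('n) - of_nat (CARD('n) - CARD('k)) = \<alpha> + of_nat CARD('k)"
      using kn by (simp add: of_nat_diff)
    then show ?thesis
      by (simp only: assms(5) assms(1-3))
  qed
  note \<mu> = \<open>invariant_stiefel_measure \<mu>\<close>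
  \<comment> \<open>The second constant is the first one with \<open>k\<close> replaced by the rank \<open>n - k\<close> of the complement.\<close>
  show ?thesis
    unfolding cosine_transform_def[abs_def] dual_cosine_transform_def[abs_def]
      sine_transform_def[abs_def] dual_sine_transform_def[abs_def] assms(1-3)
    using cosine.kernel_transform_converges_iff[OF \<mu> _ cosine_kernel_eq]
      cosine.kernel_dual_transform_converges_iff[OF \<mu> _ cosine_kernel_eq]
      sine.kernel_transform_converges_iff[OF \<mu> _ sine_eq] sine.kernel_dual_transform_converges_iff[OF \<mu> _ sine_eq]
      cosine.kernel_transform(2,3)[OF \<mu> _ cosine_kernel_eq _ c1] cosine.kernel_dual_transform(2,3)[OF \<mu> _ cosine_kernel_eq _ c1]
      sine.kernel_transform(2,3)[OF \<mu> _ sine_eq _ c2] sine.kernel_dual_transform(2,3)[OF \<mu> _ sine_eq _ c2]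
    by (intro conjI impI allI) (simp_all only: conj_imp_eq_imp_imp)
qed

end
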